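(* Let $(E,(\cdot,\cdot),\mathcal H)$ be an extended affine Lie algebra (of reduced type) with root system $R$ of type $B_\ell$ ($\ell\geq2$) such that $\mathrm{ind}(R)=0$. Then any finite order Cartan automorphism $\Psi$ of $E$ is diagonal.
   Context: All vector spaces are over $\mathbb C$. An extended affine Lie algebra is a triple $(E,(\cdot,\cdot),\mathcal H)$ where $E$ is a Lie algebra, $\mathcal H$ is a non-trivial finite dimensional subalgebra and $(\cdot,\cdot)$ is a symmetric bilinear form on $E$ such that: (A1) the form is invariant and non-degenerate; (A2) $E=\sum_{\alpha\in R}E_\alpha$ with $E_\alpha=\{x\in E\mid [h,x]=\alpha(h)x\ \forall h\in\mathcal H\}$, $R=\{\alpha\in\mathcal H^\star\mid E_\alpha\neq\{0\}\}$ and $E_0=\mathcal H$ ($R$ is the root system of $E$); the form restricted to $\mathcal H$ is then non-degenerate, $t_\alpha\in\mathcal H$ is defined by $\alpha(h)=(h,t_\alpha)$, and $(\alpha,\beta):=(t_\alpha,t_\beta)$ on $\mathcal H^\star$; $R^0=\{\alpha\in R\mid(\alpha,\alpha)=0\}$ (isotropic roots), $R^\times=R\setminus R^0$ (non-isotropic roots), and the core $E_c$ is the subalgebra generated by $E_\alpha$, $\alpha\in R^\times$; (A3) $\mathrm{ad}(x)$ is locally nilpotent for $x\in E_\alpha$, $\alpha\in R^\times$; (A4) (tameness) the centralizer of $E_c$ in $E$ is contained in $E_c$; (A5) the $\mathbb Z$-span of $R$ is a free abelian group of finite rank; (A6) if $R^\times=R_1\uplus R_2$ with $R_1,R_2$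 non-empty then $R_1\not\perp R_2$. Let $\mathcal V=\mathrm{span}_{\mathbb R}R$, $\mathcal V^0=\mathrm{span}_{\mathbb R}R^0$. The image $\bar R$ of $R$ in $\mathcal V/\mathcal V^0$ is an irreducible finite root system; its rank and type are called the rank and type of $R$ (and of $E$). Reduced type means $\bar R$ is reduced. The nullity of $R$ is $\dim\mathcal V^0$, and $\langle R\rangle$ denotes the $\mathbb Z$-span of $R$, a free abelian group of rank $\mathrm{rank}(R)+\mathrm{null}(R)$. Index: for $\alpha\in R^\times$ let $w_\alpha(\beta)=\beta-\frac{2(\alpha,\beta)}{(\alpha,\alpha)}\alpha$. For $\mathcal P\subseteq R^\times$ let $\mathcal W_{\mathcal P}$ be the group generated by $w_\alpha$, $\alpha\in\mathcal P$. A reflectable base is a subset $\mathcal P\subseteq R^\times$ with $\mathcal W_{\mathcal P}\mathcal P=R^\times$ such that no proper subset of $\mathcal P$ has this property (reflectable bases are finite). $\mathrm{refl}(R)$ is the smallest cardinality of a reflectable base, and $\mathrm{ind}(R):=\mathrm{refl}(R)-\mathrm{rank}\langle R\rangle$. A Cartan automorphism of $E$ is an automorphism $\Psi$ with $\Psi(h)=h$ for all $h\in\mathcal H$; it stabilizes each root space. It is diagonal if it acts as a scalar multiple of the identity on each root space. *)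

theory Defs
  imports
    Complex_Main
    "HOL-Library.Function_Algebras"
    "HOL-Algebra.Generated_Groups"
    "HOL-Algebra.Bij"
begin

text \<open>
  Linear functionals on a subspace \<open>H\<close> of \<open>E\<close> are represented by functions on all of \<open>E\<close> that
  vanish outside \<open>H\<close>, with the pointwise operations. Such functions are regarded both as a real
  vector space and as an abelian group.
\<close>

definition rscale :: "real \<Rightarrow> ('a \<Rightarrow> complex) \<Rightarrow> 'a \<Rightarrow> complex" where
  "rscale r f = (\<lambda>x. of_real r * f x)"

definition zscale :: "int \<Rightarrow> ('a \<Rightarrow> complex) \<Rightarrow> 'a \<Rightarrow> complex" where
  "zscale n f = (\<lambda>x. of_int n * f x)"

global_interpretation real_fun: vector_space "rscale :: real \<Rightarrow> ('a \<Rightarrow> complex) \<Rightarrow> _"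
  by unfold_locales (auto simp: rscale_def fun_eq_iff algebra_simps)

global_interpretation int_fun: module "zscale :: int \<Rightarrow> ('a \<Rightarrow> complex) \<Rightarrow> _"
  by unfold_locales (auto simp: zscale_def fun_eq_iff algebra_simps)

text \<open>\<open>B\<close> is a finite basis of the abelian group generated by \<open>S\<close>.\<close>

definition finite_int_basis :: "('a \<Rightarrow> complex) set \<Rightarrow> ('a \<Rightarrow> complex) set \<Rightarrow> bool" where
  "finite_int_basis B S \<longleftrightarrow>
     finite B \<and> \<not> int_fun.dependent B \<and> int_fun.span B = int_fun.span S"

definition int_rank :: "('a \<Rightarrow> complex) set \<Rightarrow> nat" where
  "int_rank S = (THE n. \<exists>B. finite_int_basis B S \<and> card B = n)"


text \<open>
  The root system of type \<open>B\<^sub>l\<close> in Euclidean \<open>l\<close>-space, whose vectors are the functions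
  \<open>nat \<Rightarrow> real\<close> supported on \<open>{..<l}\<close>: the short roots are \<open>\<plusminus>e\<^sub>i\<close>, the long ones \<open>\<plusminus>e\<^sub>i \<plusminus> e\<^sub>j\<close>.
\<close>

definition coord_space :: "nat \<Rightarrow> (nat \<Rightarrow> real) set" where
  "coord_space l = {v. \<forall>i\<ge>l. v i = 0}"

definition coord_inner :: "nat \<Rightarrow> (nat \<Rightarrow> real) \<Rightarrow> (nat \<Rightarrow> real) \<Rightarrow> real" where
  "coord_inner l v w = (\<Sum>i<l. v i * w i)"

definition coord_unit :: "nat \<Rightarrow> nat \<Rightarrow> real" where
  "coord_unit i = (\<lambda>k. if k = i then 1 else 0)"

definition B_roots :: "nat \<Rightarrow> (nat \<Rightarrow> real) set" where
  "B_roots l =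
     {v. \<exists>i<l. v = coord_unit i \<or> v = - coord_unit i} \<union>
     {v. \<exists>i<l. \<exists>j<l. i \<noteq> j \<and>
        (v = coord_unit i + coord_unit j \<or> v = coord_unit i - coord_unit j \<or>
         v = - coord_unit i - coord_unit j)}"


locale lie_algebra = vector_space scale
  for scale :: "complex \<Rightarrow> 'e::ab_group_add \<Rightarrow> 'e" +
  fixes bracket :: "'e \<Rightarrow> 'e \<Rightarrow> 'e"
  assumes bracket_linear_right: "\<And>x. Vector_Spaces.linear scale scale (\<lambda>y. bracket x y)"
    and bracket_linear_left: "\<And>y. Vector_Spaces.linear scale scale (\<lambda>x. bracket x y)"
    and bracket_self: "\<And>x. bracket x x = 0"
    and jacobi: "\<And>x y z. bracket x (bracket y z) + bracket y (bracket z x)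
                         + bracket z (bracket x y) = 0"
begin

definition subalgebra :: "'e set \<Rightarrow> bool" where
  "subalgebra A \<longleftrightarrow> subspace A \<and> (\<forall>x\<in>A. \<forall>y\<in>A. bracket x y \<in> A)"

definition automorphism :: "('e \<Rightarrow> 'e) \<Rightarrow> bool" where
  "automorphism \<Psi> \<longleftrightarrow> Vector_Spaces.linear scale scale \<Psi> \<and> bij \<Psi> \<and>
     (\<forall>x y. \<Psi> (bracket x y) = bracket (\<Psi> x) (\<Psi> y))"

end


locale lie_algebra_form = lie_algebra scale bracket
  for scale :: "complex \<Rightarrow> 'e::ab_group_add \<Rightarrow> 'e" and bracket :: "'e \<Rightarrow> 'e \<Rightarrow> 'e" +
  fixes form :: "'e \<Rightarrow> 'e \<Rightarrow> complex"
    and H :: "'e set"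
begin

definition dual :: "('e \<Rightarrow> complex) set" where
  "dual = {\<alpha>. (\<forall>x\<in>H. \<forall>y\<in>H. \<alpha> (x + y) = \<alpha> x + \<alpha> y) \<and>
              (\<forall>c. \<forall>x\<in>H. \<alpha> (scale c x) = c * \<alpha> x) \<and>
              (\<forall>x. x \<notin> H \<longrightarrow> \<alpha> x = 0)}"

definition root_space :: "('e \<Rightarrow> complex) \<Rightarrow> 'e set" where
  "root_space \<alpha> = {x. \<forall>h\<in>H. bracket h x = scale (\<alpha> h) x}"

definition roots :: "('e \<Rightarrow> complex) set" where
  "roots = {\<alpha> \<in> dual. root_space \<alpha> \<noteq> {0}}"

definition t_elt :: "('e \<Rightarrow> complex) \<Rightarrow> 'e" where
  "t_elt \<alpha> = (THE t. t \<in> H \<and> (\<forall>h\<in>H. \<alpha> h = form h t))"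

definition dual_form :: "('e \<Rightarrow> complex) \<Rightarrow> ('e \<Rightarrow> complex) \<Rightarrow> complex" where
  "dual_form \<alpha> \<beta> = form (t_elt \<alpha>) (t_elt \<beta>)"

definition isotropic_roots :: "('e \<Rightarrow> complex) set" where
  "isotropic_roots = {\<alpha> \<in> roots. dual_form \<alpha> \<alpha> = 0}"

definition nonisotropic_roots :: "('e \<Rightarrow> complex) set" where
  "nonisotropic_roots = roots - isotropic_roots"

definition core :: "'e set" where
  "core = subalgebra hull (\<Union>\<alpha>\<in>nonisotropic_roots. root_space \<alpha>)"

definition root_span :: "('e \<Rightarrow> complex) set" where
  "root_span = real_fun.span roots"

definition isotropic_span :: "('e \<Rightarrow> complex) set" where
  "isotropic_span = real_fun.span isotropic_roots"

text \<open>The class of \<open>\<alpha>\<close> in the quotient of \<open>root_span\<close> by \<open>isotropic_span\<close>, as a coset.\<close>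

definition bar :: "('e \<Rightarrow> complex) \<Rightarrow> ('e \<Rightarrow> complex) set" where
  "bar \<alpha> = {\<beta> \<in> root_span. \<beta> - \<alpha> \<in> isotropic_span}"

text \<open>
  The image of the roots in the quotient is isomorphic to the root system of type \<open>B\<^sub>l\<close>: a linear
  isomorphism onto \<open>l\<close>-space carries roots to roots and preserves the Cartan integers, those of
  the image being computed with the form induced from \<open>dual_form\<close>. As \<open>0\<close> is always a root, the
  image contains the zero class.
\<close>

definition has_type_B :: "nat \<Rightarrow> bool" where
  "has_type_B l \<longleftrightarrow>
     (\<exists>\<phi>. bij_betw \<phi> (bar ` root_span) (coord_space l) \<and>
          (\<forall>\<alpha>\<in>root_span. \<forall>\<beta>\<in>root_span. \<phi> (bar (\<alpha> + \<beta>)) = \<phi> (bar \<alpha>) + \<phi> (bar \<beta>)) \<and>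
          (\<forall>r. \<forall>\<alpha>\<in>root_span. \<phi> (bar (rscale r \<alpha>)) = (\<lambda>i. r * \<phi> (bar \<alpha>) i)) \<and>
          \<phi> ` (bar ` roots) = insert 0 (B_roots l) \<and>
          (\<forall>\<alpha>\<in>nonisotropic_roots. \<forall>\<beta>\<in>nonisotropic_roots.
             2 * dual_form \<alpha> \<beta> / dual_form \<alpha> \<alpha> =
             of_real (2 * coord_inner l (\<phi> (bar \<alpha>)) (\<phi> (bar \<beta>))
                        / coord_inner l (\<phi> (bar \<alpha>)) (\<phi> (bar \<alpha>)))))"

definition reflection :: "('e \<Rightarrow> complex) \<Rightarrow> ('e \<Rightarrow> complex) \<Rightarrow> 'e \<Rightarrow> complex" where
  "reflection \<alpha> \<beta> = \<beta> - (\<lambda>x. 2 * dual_form \<alpha> \<beta> / dual_form \<alpha> \<alpha> * \<alpha> x)"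

definition reflection_group :: "('e \<Rightarrow> complex) set \<Rightarrow> (('e \<Rightarrow> complex) \<Rightarrow> 'e \<Rightarrow> complex) set" where
  "reflection_group P = generate (BijGroup dual) ((\<lambda>\<alpha>. restrict (reflection \<alpha>) dual) ` P)"

definition generates_roots :: "('e \<Rightarrow> complex) set \<Rightarrow> bool" where
  "generates_roots P \<longleftrightarrow> {w \<alpha> | w \<alpha>. w \<in> reflection_group P \<and> \<alpha> \<in> P} = nonisotropic_roots"

definition reflectable_base :: "('e \<Rightarrow> complex) set \<Rightarrow> bool" where
  "reflectable_base P \<longleftrightarrow> P \<subseteq> nonisotropic_roots \<and> generates_roots P \<and>
     (\<forall>Q. Q \<subset> P \<longrightarrow> \<not> generates_roots Q)"

text \<open>Finiteness is stated because \<open>card\<close> is \<open>0\<close> on infinite sets.\<close>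

definition refl_number :: nat where
  "refl_number = (LEAST n. \<exists>P. reflectable_base P \<and> finite P \<and> card P = n)"

definition ind :: int where
  "ind = int refl_number - int (int_rank roots)"

definition cartan_automorphism :: "('e \<Rightarrow> 'e) \<Rightarrow> bool" where
  "cartan_automorphism \<Psi> \<longleftrightarrow> automorphism \<Psi> \<and> (\<forall>h\<in>H. \<Psi> h = h)"

definition diagonal :: "('e \<Rightarrow> 'e) \<Rightarrow> bool" where
  "diagonal \<Psi> \<longleftrightarrow> (\<forall>\<alpha>\<in>roots. \<exists>c. \<forall>x\<in>root_space \<alpha>. \<Psi> x = scale c x)"

end


locale extended_affine_lie_algebra = lie_algebra_form scale bracket form H
  for scale :: "complex \<Rightarrow> 'e::ab_group_add \<Rightarrow> 'e" and bracket form H +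
  assumes H_subalgebra: "subalgebra H"
    and H_nontrivial: "H \<noteq> {0}"
    and H_finite_dim: "\<exists>B. finite B \<and> H = span B"
    and form_linear: "\<And>x. Vector_Spaces.linear scale (*) (form x)"
    and form_sym: "\<And>x y. form x y = form y x"
    and form_invariant: "\<And>x y z. form (bracket x y) z = form x (bracket y z)"
    and form_nondegenerate: "\<And>x. (\<And>y. form x y = 0) \<Longrightarrow> x = 0"
    and root_space_sum: "span (\<Union>\<alpha>\<in>roots. root_space \<alpha>) = UNIV"
    and root_space_zero: "root_space 0 = H"
    and ad_locally_nilpotent:
      "\<And>\<alpha> x y. \<alpha> \<in> nonisotropic_roots \<Longrightarrow> x \<in> root_space \<alpha> \<Longrightarrow> \<exists>n. (bracket x ^^ n) y = 0"
    and tame: "{x. \<forall>y\<in>core. bracket x y = 0} \<subseteq> core"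
    and root_lattice_free: "\<exists>B. finite_int_basis B roots"
    and roots_irreducible:
      "\<And>R1 R2. R1 \<union> R2 = nonisotropic_roots \<Longrightarrow> R1 \<inter> R2 = {} \<Longrightarrow> R1 \<noteq> {} \<Longrightarrow> R2 \<noteq> {}
         \<Longrightarrow> \<exists>\<alpha>\<in>R1. \<exists>\<beta>\<in>R2. dual_form \<alpha> \<beta> \<noteq> 0"

end

theory Submission
  imports Defs
begin

text \<open>
  Every non-isotropic root space is one-dimensional (\<open>nonisotropic_root_space_one_dimensional\<close>), so a
  Cartan automorphism \<open>\<Psi>\<close> acts on it by a scalar. The task is to see that the scalars come from a single
  character \<open>\<chi>\<close> of the root lattice, and that \<open>\<Psi>\<close> acts by \<open>\<chi>\<close> on the isotropic root spaces too, whose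
  dimension can be arbitrary.

  Index zero provides the character. A reflectable base \<open>P\<close> generates the root lattice: by tameness the
  isotropic roots are integral combinations of the non-isotropic ones
  (\<open>isotropic_in_int_span_nonisotropic\<close>), and those are obtained from \<open>P\<close> by reflections with integral
  Cartan numbers. If \<open>P\<close> has as many elements as the rank of the lattice, it is a basis
  (\<open>index_zero_int_basis\<close>), and \<open>\<chi>\<close> can be prescribed on \<open>P\<close> by the scalars of \<open>\<Psi>\<close>. For the index
  to say anything about an actual base, a finite reflectable base must exist
  (\<open>refl_number_attained\<close>): two reflections in roots with the same image in the finite quotient
  root system compose to a translation by twice their difference, and these translations have finitely
  many orbits on the roots above a given element of the quotient.

  If \<open>\<Psi>\<close> acts by \<open>\<chi>\<close> on the root spaces of \<open>\<plusminus>\<gamma>\<close> and \<open>\<beta>\<close>, then also on the root space of the reflection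
  of \<open>\<beta>\<close> in \<open>\<gamma>\<close>, because that space is spanned by \<open>e\<^sup>n x\<close> with \<open>e\<close> a root vector for \<open>\<gamma>\<close> or \<open>- \<gamma>\<close>
  and \<open>x\<close> one for \<open>\<beta>\<close> (\<open>raising_to_reflected_root_space\<close>). Hence \<open>\<Psi>\<close> acts by \<open>\<chi>\<close> on all non-isotropic
  root spaces, and then on the core.

  Let \<open>x\<close> be a root vector for an isotropic \<open>\<sigma>\<close>, and put \<open>y = \<chi>(\<sigma>)\<^sup>-\<^sup>1 \<Psi> x - x\<close>. Comparing the
  action on \<open>[x, z]\<close> and \<open>z\<close>, for \<open>z\<close> in a non-isotropic root space, shows that \<open>y\<close> centralizes the core
  (\<open>isotropic_deviation_in_core\<close>). By tameness \<open>y\<close> is in the core, so \<open>\<Psi> y = \<chi>(\<sigma>) y\<close> and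
  \<open>\<Psi>\<^sup>n x = \<chi>(\<sigma>)\<^sup>n (x + n y)\<close>. Finite order forces \<open>y = 0\<close> (\<open>finite_order_diagonal\<close>).
\<close>

section \<open>Finitely generated groups of functions\<close>

text \<open>
  The integers that occur as \<open>b\<close>-coefficients of elements of \<open>G\<close> form an ideal, hence are the
  multiples of one of them, \<open>d\<close>. An element of \<open>G\<close> with coefficient \<open>d\<close>, added to generators of the
  part of \<open>G\<close> inside the span of the remaining elements of \<open>B\<close>, generates \<open>G\<close>.
\<close>

lemma subgroup_finitely_generated:
  assumes "finite B" "int_fun.subspace G" "G \<subseteq> int_fun.span B"
  shows "\<exists>F. finite F \<and> int_fun.span F = G"
  using assms
proof (induction B arbitrary: G rule: finite_induct)
  case empty
  then have "G = {0}"
    using int_fun.subspace_0 by fastforce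
  then show ?case
    by (intro exI[of _ "{}"]) auto
next
  case (insert b B)
  define I where "I = {k. \<exists>g\<in>G. g - zscale k b \<in> int_fun.span B}"
  have "int_fun.subspace (G \<inter> int_fun.span B)"
    using insert.prems by (intro int_fun.subspace_inter) auto
  from insert.IH[OF this] obtain F where F: "finite F" "int_fun.span F = G \<inter> int_fun.span B"
    by auto
  have coeff: "\<exists>k\<in>I. x - zscale k b \<in> int_fun.span B" if "x \<in> G" for x
    using that insert.prems(2) unfolding I_def by (simp add: int_fun.span_insert subset_iff) blast
  have comb: "k - q * d \<in> I" if "k \<in> I" "d \<in> I" for k d q
  proof -
    obtain x g where xg: "x \<in> G" "x - zscale k b \<in> int_fun.span B"
      "g \<in> G" "g - zscale d b \<in> int_fun.span B"
      using \<open>k \<in> I\<close> \<open>d \<in> I\<close> unfolding I_def by auto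
    have "x - zscale q g - zscale (k - q * d) b
        = (x - zscale k b) - zscale q (g - zscale d b)"
      by (auto simp: zscale_def fun_eq_iff algebra_simps)
    also have "\<dots> \<in> int_fun.span B"
      by (rule int_fun.span_diff[OF xg(2) int_fun.span_scale[OF xg(4)]])
    finally have "x - zscale q g - zscale (k - q * d) b \<in> int_fun.span B" .
    moreover have "x - zscale q g \<in> G"
      by (rule int_fun.subspace_diff[OF insert.prems(1) xg(1) int_fun.subspace_scale[OF insert.prems(1) xg(3)]])
    ultimately show ?thesis
      unfolding I_def by blast
  qed
  have "\<exists>d\<in>I. \<forall>k\<in>I. d dvd k"
  proof (cases "\<exists>k\<in>I. k > 0")
    case True
    define n where "n = (LEAST n. n > 0 \<and> int n \<in> I)"
    have ex: "\<exists>n>0. int n \<in> I"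
      using True by (metis zero_less_imp_eq_int)
    then have n: "n > 0" "int n \<in> I"
      using LeastI_ex[OF ex] unfolding n_def by auto
    have min: "m \<ge> n" if "m > 0" "int m \<in> I" for m
      unfolding n_def using that by (intro Least_le) auto
    have "int n dvd k" if "k \<in> I" for k
    proof -
      have "k mod int n \<in> I"
        using comb[OF that n(2), of "k div int n"] by (simp add: minus_div_mult_eq_mod)
      moreover have "0 \<le> k mod int n" "k mod int n < int n"
        using n by simp_all
      ultimately have "k mod int n = 0"
        using min[of "nat (k mod int n)"] by (cases "k mod int n = 0") auto
      then show ?thesis
        by (rule mod_0_imp_dvd)
    qed
    with n show ?thesis
      by blast
  next
    case False
    have "0 \<in> G"
      using insert.prems(1) by (rule int_fun.subspace_0)
    then obtain k where "k \<in> I"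
      using coeff by blast
    then have "0 \<in> I"
      using comb[of k k 1] by simp
    moreover have "k = 0" if "k \<in> I" for k
      using that False comb[OF \<open>0 \<in> I\<close> that, of 1] by (metis linorder_neqE_linordered_idom mult_1
          diff_0 neg_0_less_iff_less)
    ultimately show ?thesis
      by auto
  qed
  then obtain d g where d: "\<forall>k\<in>I. d dvd k" and g: "g \<in> G" "g - zscale d b \<in> int_fun.span B"
    unfolding I_def by blast
  have "x \<in> int_fun.span (insert g F)" if "x \<in> G" for x
  proof -
    obtain k where k: "k \<in> I" "x - zscale k b \<in> int_fun.span B"
      using coeff[OF \<open>x \<in> G\<close>] by blast
    obtain q where q: "k = d * q"
      using d k(1) by (auto elim: dvdE)
    have "x - zscale q g = (x - zscale k b) - zscale q (g - zscale d b)"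
      by (auto simp: q zscale_def fun_eq_iff algebra_simps)
    also have "\<dots> \<in> int_fun.span B"
      by (rule int_fun.span_diff[OF k(2) int_fun.span_scale[OF g(2)]])
    finally have "x - zscale q g \<in> int_fun.span F"
      using that g insert.prems(1) F(2)
      by (auto intro!: int_fun.subspace_diff int_fun.subspace_scale)
    then show ?thesis
      by (auto simp: int_fun.span_insert)
  qed
  moreover have "insert g F \<subseteq> G"
    using F g int_fun.span_superset[of F] by auto
  ultimately have "int_fun.span (insert g F) = G"
    using insert.prems(1) int_fun.span_minimal[of "insert g F" G] by blast
  then show ?case
    using F(1) by blast
qed

text \<open>
  Finitely many generators of the span of \<open>X\<close> involve only finitely many elements of \<open>X\<close>.
\<close>

lemma finite_generating_subset:
  assumes "finite B" "X \<subseteq> int_fun.span B"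
  obtains F where "finite F" "F \<subseteq> X" "int_fun.span F = int_fun.span X"
proof -
  have "int_fun.span X \<subseteq> int_fun.span B"
    using assms(2) by (intro int_fun.span_minimal) auto
  then obtain F0 where F0: "finite F0" "int_fun.span F0 = int_fun.span X"
    using subgroup_finitely_generated[OF assms(1) int_fun.subspace_span] by blast
  have "\<exists>T. finite T \<and> T \<subseteq> X \<and> f \<in> int_fun.span T" if "f \<in> F0" for f
  proof -
    have "f \<in> int_fun.span X"
      using that F0(2) int_fun.span_superset by blast
    then obtain T r where T: "finite T" "T \<subseteq> X" "f = (\<Sum>a\<in>T. zscale (r a) a)"
      unfolding int_fun.span_explicit by blast
    then have "f \<in> int_fun.span T"
      by (auto intro: int_fun.span_sum int_fun.span_scale int_fun.span_base)
    with T show ?thesis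
      by blast
  qed
  then obtain T where T: "\<And>f. f \<in> F0 \<Longrightarrow> finite (T f) \<and> T f \<subseteq> X \<and> f \<in> int_fun.span (T f)"
    by metis
  let ?F = "\<Union>f\<in>F0. T f"
  have "F0 \<subseteq> int_fun.span ?F"
  proof
    fix f assume "f \<in> F0"
    then show "f \<in> int_fun.span ?F"
      using T[of f] int_fun.span_mono[of "T f" ?F] by blast
  qed
  then have "int_fun.span X \<subseteq> int_fun.span ?F"
    unfolding F0(2)[symmetric] by (intro int_fun.span_minimal) auto
  moreover have "?F \<subseteq> X"
    using T by blast
  ultimately show ?thesis
    using that[of ?F] F0(1) T int_fun.span_mono[of ?F X] by blast
qed

definition qscale :: "rat \<Rightarrow> ('a \<Rightarrow> complex) \<Rightarrow> 'a \<Rightarrow> complex" where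
  "qscale r f = (\<lambda>x. of_rat r * f x)"

interpretation rat_fun: vector_space "qscale :: rat \<Rightarrow> ('a \<Rightarrow> complex) \<Rightarrow> _"
  by unfold_locales (auto simp: qscale_def fun_eq_iff algebra_simps of_rat_add of_rat_mult)

lemma qscale_of_int: "qscale (of_int k) f = zscale k f"
  by (simp add: qscale_def zscale_def)

lemma int_span_subset_rat_span: "int_fun.span S \<subseteq> rat_fun.span S"
proof (rule int_fun.span_minimal)
  show "S \<subseteq> rat_fun.span S"
    by (rule rat_fun.span_superset)
  show "int_fun.subspace (rat_fun.span S)"
    by (auto simp: int_fun.subspace_def rat_fun.span_zero rat_fun.span_add
        simp flip: qscale_of_int intro: rat_fun.span_scale)
qed

lemma common_denominator:
  fixes u :: "'b \<Rightarrow> rat"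
  assumes "finite B"
  shows "\<exists>N>0. \<forall>b\<in>B. of_int N * u b \<in> \<int>"
  using assms
proof (induction B rule: finite_induct)
  case empty
  then show ?case by (intro exI[of _ 1]) auto
next
  case (insert b B)
  then obtain N where N: "N > 0" "\<And>c. c \<in> B \<Longrightarrow> of_int N * u c \<in> \<int>"
    by blast
  obtain p q where pq: "u b = of_int p / of_int q" "q > 0"
    by (metis quotient_of_denom_pos quotient_of_div surj_pair)
  have "of_int (N * q) * u c \<in> \<int>" if "c \<in> insert b B" for c
  proof (cases "c = b")
    case True
    then have "of_int (N * q) * u c = of_int (N * p)"
      using pq by simp
    then show ?thesis
      by (metis Ints_of_int)
  next
    case False
    then have "of_int N * u c \<in> \<int>"
      using that N(2) by blast
    then have "of_int q * (of_int N * u c) \<in> \<int>"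
      by (rule Ints_mult[OF Ints_of_int])
    then show ?thesis
      by (simp add: mult_ac)
  qed
  then show ?case
    using N(1) pq(2) by (intro exI[of _ "N * q"]) auto
qed

text \<open>
  Clearing denominators turns a rational relation into an integral one. Integral bases can therefore be
  compared by the exchange property of vector spaces over the rationals, which fails over the integers.
\<close>

lemma rat_independent_iff:
  assumes "finite B"
  shows "rat_fun.dependent B \<longleftrightarrow> int_fun.dependent B"
proof
  assume "int_fun.dependent B"
  then obtain u v where u: "v \<in> B" "u v \<noteq> 0" "(\<Sum>b\<in>B. zscale (u b) b) = 0"
    unfolding int_fun.dependent_finite[OF assms] by blast
  then show "rat_fun.dependent B"
    unfolding rat_fun.dependent_finite[OF assms]
    by (intro exI[of _ "\<lambda>b. of_int (u b)"]) (auto simp: qscale_of_int)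
next
  assume "rat_fun.dependent B"
  then obtain u v where u: "v \<in> B" "u v \<noteq> 0" "(\<Sum>b\<in>B. qscale (u b) b) = 0"
    unfolding rat_fun.dependent_finite[OF assms] by blast
  obtain N where N: "N > 0" "\<And>b. b \<in> B \<Longrightarrow> of_int N * u b \<in> \<int>"
    using common_denominator[OF assms] by blast
  then have "\<forall>b\<in>B. \<exists>k. of_int N * u b = of_int k"
    by (blast elim: Ints_cases)
  then obtain w where w: "\<And>b. b \<in> B \<Longrightarrow> of_int N * u b = of_int (w b)"
    by (metis (no_types))
  have "(\<Sum>b\<in>B. zscale (w b) b) = (\<Sum>b\<in>B. qscale (of_int N) (qscale (u b) b))"
    by (intro sum.cong refl) (simp add: w flip: qscale_of_int)
  also have "\<dots> = qscale (of_int N) (\<Sum>b\<in>B. qscale (u b) b)"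
    by (simp add: rat_fun.scale_sum_right)
  finally have "(\<Sum>b\<in>B. zscale (w b) b) = 0"
    using u by simp
  moreover have "w v \<noteq> 0"
    using w[OF u(1)] u(2) N(1) by auto
  ultimately show "int_fun.dependent B"
    unfolding int_fun.dependent_finite[OF assms] using u(1) by blast
qed

lemma int_rank_eq_card:
  assumes "finite_int_basis B S"
  shows "int_rank S = card B"
proof -
  have "card B' \<le> card B''" if "finite_int_basis B' S" "finite_int_basis B'' S" for B' B''
  proof -
    have "B' \<subseteq> rat_fun.span B''"
      using that int_span_subset_rat_span[of B''] int_fun.span_superset[of B']
      unfolding finite_int_basis_def by auto
    then show ?thesis
      using that rat_fun.independent_span_bound[of B'' B'] rat_independent_iff[of B']
      unfolding finite_int_basis_def by auto
  qed
  then show ?thesis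
    unfolding int_rank_def using assms by (intro the_equality) (blast, metis antisym)
qed

text \<open>
  If \<open>P\<close> were dependent, one of its elements could be dropped without changing the rational span,
  and too few elements would span a basis of the group.
\<close>

lemma generating_set_of_rank_card_independent:
  assumes "finite_int_basis B S" "finite P" "S \<subseteq> int_fun.span P" "card P = int_rank S"
  shows "\<not> int_fun.dependent P"
proof
  assume "int_fun.dependent P"
  then obtain a where a: "a \<in> P" "a \<in> rat_fun.span (P - {a})"
    using rat_independent_iff[OF assms(2)] unfolding rat_fun.dependent_def by blast
  have "B \<subseteq> int_fun.span S"
    using assms(1) int_fun.span_superset unfolding finite_int_basis_def by blast
  also have "\<dots> \<subseteq> int_fun.span P"
    using assms(3) by (intro int_fun.span_minimal) auto
  also have "\<dots> \<subseteq> rat_fun.span P"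
    by (rule int_span_subset_rat_span)
  also have "\<dots> \<subseteq> rat_fun.span (P - {a})"
    using a rat_fun.span_superset[of "P - {a}"] by (intro rat_fun.span_minimal) auto
  finally have "card B \<le> card (P - {a})"
    using rat_fun.independent_span_bound[of "P - {a}" B] assms(1,2) rat_independent_iff[of B]
    unfolding finite_int_basis_def by auto
  moreover have "card (P - {a}) < card P"
    using a(1) assms(2) by (intro psubset_card_mono) auto
  ultimately show False
    using assms(4) int_rank_eq_card[OF assms(1)] by simp
qed

lemma character_with_values_on_basis:
  fixes c :: "('a \<Rightarrow> complex) \<Rightarrow> complex"
  assumes "\<not> int_fun.dependent P" "finite P" "\<And>p. p \<in> P \<Longrightarrow> c p \<noteq> 0"
  obtains \<chi> where "\<And>p. p \<in> P \<Longrightarrow> \<chi> p = c p"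
    "\<And>x. \<chi> x \<noteq> 0"
    "\<And>x y. x \<in> int_fun.span P \<Longrightarrow> y \<in> int_fun.span P \<Longrightarrow> \<chi> (x + y) = \<chi> x * \<chi> y"
proof
  define \<chi> where "\<chi> x = (\<Prod>p\<in>P. c p powi int_fun.representation P x p)" for x
  show "\<chi> p = c p" if "p \<in> P" for p
  proof -
    have "\<chi> p = (\<Prod>q\<in>P. if q = p then c p else 1)"
      unfolding \<chi>_def using assms(1) that
      by (intro prod.cong) (auto simp: int_fun.representation_basis)
    then show ?thesis
      using that assms(2) by simp
  qed
  show "\<chi> x \<noteq> 0" for x
    unfolding \<chi>_def using assms(2,3) by simp
  show "\<chi> (x + y) = \<chi> x * \<chi> y" if "x \<in> int_fun.span P" "y \<in> int_fun.span P" for x y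
  proof -
    have "c p powi (a + b) = c p powi a * c p powi b" if "p \<in> P" for p a b
      using assms(3)[OF that] by (simp add: power_int_add)
    then show ?thesis
      unfolding \<chi>_def int_fun.representation_add[OF assms(1) that(2,1)]
      by (simp add: prod.distrib)
  qed
qed

section \<open>Representations of the three-dimensional simple Lie algebra\<close>

context lie_algebra
begin

lemma bracket_add_right: "bracket x (y + z) = bracket x y + bracket x z"
  and bracket_scale_right: "bracket x (scale c y) = scale c (bracket x y)"
  using bracket_linear_right[of x] by (auto simp: Vector_Spaces.linear_iff)

lemma bracket_add_left: "bracket (x + y) z = bracket x z + bracket y z"
  and bracket_scale_left: "bracket (scale c x) z = scale c (bracket x z)"
  using bracket_linear_left[of z] by (auto simp: Vector_Spaces.linear_iff)

lemma bracket_zero_right: "bracket x 0 = 0"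
  using bracket_scale_right[of x 0 0] by simp

lemma bracket_zero_left: "bracket 0 x = 0"
  using bracket_scale_left[of 0 0 x] by simp

lemma bracket_minus_right: "bracket x (- y) = - bracket x y"
  using bracket_scale_right[of x "- 1" y] by simp

lemma bracket_minus_left: "bracket (- x) y = - bracket x y"
  using bracket_scale_left[of "- 1" x y] by simp

lemma bracket_diff_right: "bracket x (y - z) = bracket x y - bracket x z"
  using bracket_add_right[of x y "- z"] by (simp add: bracket_minus_right)

lemma bracket_diff_left: "bracket (x - y) z = bracket x z - bracket y z"
  using bracket_add_left[of x "- y" z] by (simp add: bracket_minus_left)

lemma bracket_sum_right: "bracket x (\<Sum>i\<in>I. f i) = (\<Sum>i\<in>I. bracket x (f i))"
  by (induction I rule: infinite_finite_induct) (auto simp: bracket_zero_right bracket_add_right)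

lemma bracket_antisym: "bracket x y = - bracket y x"
proof -
  have "bracket (x + y) (x + y) = (bracket x x + bracket x y) + (bracket y x + bracket y y)"
    by (simp only: bracket_add_left bracket_add_right add_ac)
  then show ?thesis
    by (simp add: bracket_self eq_neg_iff_add_eq_0)
qed

lemma bracket_derivation: "bracket x (bracket y z) = bracket (bracket x y) z + bracket y (bracket x z)"
proof -
  have "bracket y (bracket x z) = - bracket y (bracket z x)"
    by (subst bracket_antisym[of x z]) (rule bracket_minus_right)
  moreover have "bracket (bracket x y) z = - bracket z (bracket x y)"
    by (rule bracket_antisym)
  ultimately show ?thesis
    using jacobi[of x y z] by (simp add: algebra_simps) (metis add.assoc add.commute add_eq_0_iff)
qed

lemma subspace_kernel_ad: "subspace {y. bracket x y = 0}"
  by (auto simp: subspace_def bracket_zero_right bracket_add_right bracket_scale_right)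

lemma ad_power_weight:
  assumes "bracket h e = scale 2 e" "bracket h v = scale \<mu> v"
  shows "bracket h ((bracket e ^^ n) v) = scale (\<mu> + 2 * of_nat n) ((bracket e ^^ n) v)"
proof (induction n)
  case 0
  then show ?case using assms(2) by simp
next
  case (Suc n)
  have "bracket h ((bracket e ^^ Suc n) v)
      = scale 2 ((bracket e ^^ Suc n) v) + scale (\<mu> + 2 * of_nat n) ((bracket e ^^ Suc n) v)"
    by (simp only: funpow.simps o_apply bracket_derivation[of h e] assms(1) Suc.IH
        bracket_scale_left bracket_scale_right)
  also have "\<dots> = scale (2 + (\<mu> + 2 * of_nat n)) ((bracket e ^^ Suc n) v)"
    by (rule scale_left_distrib[symmetric])
  also have "2 + (\<mu> + 2 * of_nat n) = \<mu> + 2 * of_nat (Suc n)"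
    by simp
  finally show ?case .
qed

text \<open>
  The standard commutation rule in a representation of \<open>sl\<^sub>2\<close>: moving \<open>f\<close> past \<open>e\<^sup>n\<^sup>+\<^sup>1\<close>
  produces one term \<open>- h\<close> for each factor \<open>e\<close> that is passed.
\<close>

lemma lowering_raising_power:
  assumes "bracket h e = scale 2 e" "bracket e f = h" "bracket h v = scale \<mu> v"
  shows "bracket f ((bracket e ^^ Suc n) v) = (bracket e ^^ Suc n) (bracket f v)
    - scale (of_nat (Suc n) * (\<mu> + of_nat n)) ((bracket e ^^ n) v)"
proof -
  have fe: "bracket f (bracket e w) = bracket e (bracket f w) - bracket h w" for w
    using bracket_derivation[of f e w] bracket_antisym[of f e] assms(2)
    by (simp add: bracket_minus_left)
  show ?thesis
  proof (induction n)
    case 0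
    then show ?case
      using fe[of v] assms(3) by simp
  next
    case (Suc n)
    have "bracket f ((bracket e ^^ Suc (Suc n)) v)
        = bracket e (bracket f ((bracket e ^^ Suc n) v)) - bracket h ((bracket e ^^ Suc n) v)"
      using fe by simp
    also have "\<dots> = (bracket e ^^ Suc (Suc n)) (bracket f v)
        - scale (of_nat (Suc n) * (\<mu> + of_nat n)) ((bracket e ^^ Suc n) v)
        - scale (\<mu> + 2 * of_nat (Suc n)) ((bracket e ^^ Suc n) v)"
      unfolding Suc.IH ad_power_weight[OF assms(1,3)]
      by (simp add: bracket_diff_right bracket_scale_right)
    also have "\<dots> = (bracket e ^^ Suc (Suc n)) (bracket f v)
        - scale (of_nat (Suc n) * (\<mu> + of_nat n) + (\<mu> + 2 * of_nat (Suc n))) ((bracket e ^^ Suc n) v)"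
      unfolding scale_left_distrib by simp
    also have "of_nat (Suc n) * (\<mu> + of_nat n) + (\<mu> + 2 * of_nat (Suc n))
        = of_nat (Suc (Suc n)) * (\<mu> + of_nat (Suc n))"
      by (simp add: algebra_simps)
    finally show ?case .
  qed
qed

text \<open>
  Applying \<open>f\<close> to \<open>e\<^sup>j\<^sup>+\<^sup>1 v\<close> gives a multiple of \<open>e\<^sup>j v\<close> that is nonzero unless \<open>\<mu> = - j\<close>,
  so the vanishing of a power of \<open>e\<close> on \<open>v\<close> descends to \<open>v\<close> itself.
\<close>

lemma lowest_weight_vector_zero:
  assumes "bracket h e = scale 2 e" "bracket e f = h" "bracket h v = scale \<mu> v"
    and "bracket f v = 0" "(bracket e ^^ n) v = 0" "\<And>j. j < n \<Longrightarrow> \<mu> + of_nat j \<noteq> 0"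
  shows "v = 0"
  using assms(5,6)
proof (induction n)
  case 0
  then show ?case by simp
next
  case (Suc n)
  have zero: "(bracket e ^^ k) 0 = 0" for k
    by (induction k) (auto simp: bracket_zero_right)
  have "scale (of_nat (Suc n) * (\<mu> + of_nat n)) ((bracket e ^^ n) v) = 0"
    using lowering_raising_power[OF assms(1-3), of n] assms(4) Suc.prems(1)
    by (simp only: bracket_zero_right zero) simp
  moreover have "of_nat (Suc n) * (\<mu> + of_nat n) \<noteq> 0"
    using Suc.prems(2)[of n] by (metis lessI mult_eq_0_iff of_nat_neq_0)
  ultimately have "(bracket e ^^ n) v = 0"
    by simp
  with Suc show ?case
    by auto
qed

text \<open>
  If \<open>e\<^sup>k v = 0\<close>, the commutation rule gives \<open>e\<^sup>k\<^sup>+\<^sup>2 (f v) = 0\<close>, where \<open>f v\<close> has weight \<open>- (k + 2)\<close> and is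
  killed by a smaller power of \<open>f\<close> than \<open>v\<close>. By induction \<open>f v = 0\<close>, so \<open>v\<close> is a lowest weight vector,
  and \<open>e\<^sup>k\<close> does not kill a nonzero lowest weight vector of weight \<open>- k\<close>.
\<close>

lemma raising_power_injective:
  assumes "bracket h e = scale 2 e" "bracket h f = scale (- 2) f" "bracket e f = h"
    and "bracket h v = scale (- of_nat k) v" "(bracket f ^^ m) v = 0" "(bracket e ^^ k) v = 0"
  shows "v = 0"
  using assms(4-6)
proof (induction m arbitrary: v k)
  case 0
  then show ?case by simp
next
  case (Suc m)
  have weight: "bracket h (bracket f v) = scale (- of_nat (k + 2)) (bracket f v)"
    unfolding bracket_derivation[of h f] assms(2) Suc.prems(1) bracket_scale_left bracket_scale_right
    by (simp add: scale_left_diff_distrib)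
  have zero: "(bracket e ^^ Suc k) v = 0" "(bracket e ^^ Suc (Suc k)) v = 0"
    using Suc.prems(3) by (simp_all add: bracket_zero_right)
  have "(bracket e ^^ (k + 2)) (bracket f v) = 0"
    using lowering_raising_power[OF assms(1,3) Suc.prems(1), of "Suc k"] zero
    by (simp add: bracket_zero_right)
  moreover have "(bracket f ^^ m) (bracket f v) = 0"
    using Suc.prems(2) by (simp add: funpow_swap1)
  ultimately have "bracket f v = 0"
    using Suc.IH[OF weight] by blast
  moreover have "- of_nat k + (of_nat j :: complex) \<noteq> 0" if "j < k" for j
    using that by auto
  ultimately show ?case
    using lowest_weight_vector_zero[OF assms(1,3) Suc.prems(1) _ Suc.prems(3)] by blast
qed

end

section \<open>Root spaces and the form\<close>

context lie_algebra_form
begin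

lemma dual_zero: "0 \<in> dual"
  and dual_add: "\<alpha> \<in> dual \<Longrightarrow> \<beta> \<in> dual \<Longrightarrow> \<alpha> + \<beta> \<in> dual"
  and dual_minus: "\<alpha> \<in> dual \<Longrightarrow> - \<alpha> \<in> dual"
  and dual_scale: "\<alpha> \<in> dual \<Longrightarrow> (\<lambda>x. c * \<alpha> x) \<in> dual"
  by (auto simp: dual_def algebra_simps)

lemma dual_diff: "\<alpha> \<in> dual \<Longrightarrow> \<beta> \<in> dual \<Longrightarrow> \<alpha> - \<beta> \<in> dual"
  using dual_add[of \<alpha> "- \<beta>"] dual_minus[of \<beta>] by simp

lemma dual_separated:
  assumes "\<alpha> \<in> dual" "\<beta> \<in> dual" "\<alpha> \<noteq> \<beta>"
  obtains h where "h \<in> H" "\<alpha> h \<noteq> \<beta> h"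
  using assms by (auto simp: dual_def fun_eq_iff) metis

lemma roots_in_dual: "\<alpha> \<in> roots \<Longrightarrow> \<alpha> \<in> dual"
  by (simp add: roots_def)

lemma nonisotropic_in_roots: "\<alpha> \<in> nonisotropic_roots \<Longrightarrow> \<alpha> \<in> roots"
  by (simp add: nonisotropic_roots_def)

lemma nonisotropic_in_dual: "\<alpha> \<in> nonisotropic_roots \<Longrightarrow> \<alpha> \<in> dual"
  by (simp add: nonisotropic_in_roots roots_in_dual)

lemma nonisotropic_iff: "\<alpha> \<in> nonisotropic_roots \<longleftrightarrow> \<alpha> \<in> roots \<and> dual_form \<alpha> \<alpha> \<noteq> 0"
  by (auto simp: nonisotropic_roots_def isotropic_roots_def)

lemma subspace_root_space: "subspace (root_space \<alpha>)"
  by (auto simp: subspace_def root_space_def bracket_zero_right bracket_add_right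
      bracket_scale_right scale_right_distrib mult.commute)

lemma rootI: "\<alpha> \<in> dual \<Longrightarrow> x \<in> root_space \<alpha> \<Longrightarrow> x \<noteq> 0 \<Longrightarrow> \<alpha> \<in> roots"
  by (auto simp: roots_def)

lemma root_vectorE:
  assumes "\<alpha> \<in> roots"
  obtains x where "x \<in> root_space \<alpha>" "x \<noteq> 0"
  using assms subspace_0[OF subspace_root_space, of \<alpha>] by (auto simp: roots_def)

lemma bracket_root_space:
  assumes "x \<in> root_space \<alpha>" "y \<in> root_space \<beta>"
  shows "bracket x y \<in> root_space (\<alpha> + \<beta>)"
  using assms
  by (auto simp: root_space_def bracket_derivation[of _ x y] bracket_scale_left
      bracket_scale_right scale_left_distrib)

lemma ad_power_root_space:
  assumes "x \<in> root_space \<alpha>" "y \<in> root_space \<beta>"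
  shows "(bracket x ^^ n) y \<in> root_space (\<beta> + (\<lambda>z. of_nat n * \<alpha> z))"
proof (induction n)
  case 0
  then show ?case using assms(2) by (simp add: plus_fun_def)
next
  case (Suc n)
  have "\<alpha> + (\<beta> + (\<lambda>z. of_nat n * \<alpha> z)) = \<beta> + (\<lambda>z. of_nat (Suc n) * \<alpha> z)"
    by (auto simp: fun_eq_iff algebra_simps)
  then show ?case
    using bracket_root_space[OF assms(1) Suc] by (simp only: funpow.simps o_apply)
qed

text \<open>
  Applying \<open>h - \<nu> h\<close> to a relation removes the component of weight \<open>\<nu>\<close> and multiplies each other
  component by a scalar, which is nonzero for a suitable \<open>h\<close>.
\<close>

lemma weight_vectors_independent:
  assumes "finite F" "F \<subseteq> dual" "\<And>\<rho>. \<rho> \<in> F \<Longrightarrow> x \<rho> \<in> root_space \<rho>" "(\<Sum>\<rho>\<in>F. x \<rho>) = 0" "\<mu> \<in> F"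
  shows "x \<mu> = 0"
  using assms
proof (induction F arbitrary: x \<mu> rule: finite_induct)
  case empty
  then show ?case by simp
next
  case (insert \<nu> F)
  have zero: "x \<rho> = 0" if \<rho>: "\<rho> \<in> F" for \<rho>
  proof -
    have "\<rho> \<noteq> \<nu>" "\<rho> \<in> dual" "\<nu> \<in> dual"
      using insert.hyps insert.prems(1) \<rho> by auto
    then obtain h where h: "h \<in> H" "\<rho> h \<noteq> \<nu> h"
      using dual_separated by metis
    have "(\<Sum>\<kappa>\<in>F. scale (\<kappa> h - \<nu> h) (x \<kappa>)) = (\<Sum>\<kappa>\<in>insert \<nu> F. scale (\<kappa> h - \<nu> h) (x \<kappa>))"
      using insert.hyps by simp
    also have "\<dots> = (\<Sum>\<kappa>\<in>insert \<nu> F. bracket h (x \<kappa>) - scale (\<nu> h) (x \<kappa>))"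
      using insert.prems(2) h(1)
      by (intro sum.cong) (auto simp: scale_left_diff_distrib root_space_def)
    also have "\<dots> = bracket h (\<Sum>\<kappa>\<in>insert \<nu> F. x \<kappa>) - scale (\<nu> h) (\<Sum>\<kappa>\<in>insert \<nu> F. x \<kappa>)"
      by (simp only: sum_subtractf scale_sum_right bracket_sum_right)
    finally have "(\<Sum>\<kappa>\<in>F. scale (\<kappa> h - \<nu> h) (x \<kappa>)) = 0"
      unfolding insert.prems(3) by (simp add: bracket_zero_right)
    moreover have "scale (\<kappa> h - \<nu> h) (x \<kappa>) \<in> root_space \<kappa>" if "\<kappa> \<in> F" for \<kappa>
      using that insert.prems(2) by (intro subspace_scale[OF subspace_root_space]) auto
    ultimately have "scale (\<rho> h - \<nu> h) (x \<rho>) = 0"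
      using insert.IH[of "\<lambda>\<kappa>. scale (\<kappa> h - \<nu> h) (x \<kappa>)" \<rho>] insert.prems(1) \<rho> by auto
    then show ?thesis
      using h(2) by simp
  qed
  moreover have "x \<nu> = 0"
    using insert.prems(3) insert.hyps zero by simp
  ultimately show ?case
    using insert.prems(4) by auto
qed

end

context extended_affine_lie_algebra
begin

lemma form_add_right: "form x (y + z) = form x y + form x z"
  and form_scale_right: "form x (scale c y) = c * form x y"
  using form_linear[of x] by (auto simp: Vector_Spaces.linear_iff)

lemma form_zero_right: "form x 0 = 0"
  using form_scale_right[of x 0 0] by simp

lemma form_diff_right: "form x (y - z) = form x y - form x z"
  using form_add_right[of x "y - z" z] by simp

lemma form_add_left: "form (x + y) z = form x z + form y z"
  and form_scale_left: "form (scale c x) z = c * form x z"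
  and form_diff_left: "form (x - y) z = form x z - form y z"
  using form_add_right form_scale_right form_diff_right form_sym by metis+

lemma subspace_H: "subspace H"
  using H_subalgebra by (simp add: subalgebra_def)

lemma root_spaces_orthogonal:
  assumes "\<alpha> \<in> dual" "\<beta> \<in> dual" "x \<in> root_space \<alpha>" "y \<in> root_space \<beta>" "\<alpha> + \<beta> \<noteq> 0"
  shows "form x y = 0"
proof -
  obtain h where h: "h \<in> H" "(\<alpha> + \<beta>) h \<noteq> 0"
    using dual_separated[OF dual_add[OF assms(1,2)] dual_zero assms(5)] by auto
  have "\<alpha> h * form x y = form (bracket h x) y"
    using assms(3) h(1) by (simp add: root_space_def form_scale_left)
  also have "\<dots> = - form x (bracket h y)"
    using form_invariant[of x h y] bracket_antisym[of h x]
    by (metis add.inverse_inverse form_scale_left mult_minus1 scale_minus_left scale_one)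
  also have "\<dots> = - \<beta> h * form x y"
    using assms(4) h(1) by (simp add: root_space_def form_scale_right)
  finally have "(\<alpha> + \<beta>) h * form x y = 0"
    by (simp add: algebra_simps)
  with h(2) show ?thesis
    by (metis mult_eq_0_iff)
qed

text \<open>
  A vector of weight \<open>\<alpha>\<close> is orthogonal to all root spaces except that of \<open>- \<alpha>\<close>, and the root spaces
  span the algebra.
\<close>

lemma root_vector_pairing:
  assumes "\<alpha> \<in> dual" "x \<in> root_space \<alpha>" "x \<noteq> 0"
  obtains y where "y \<in> root_space (- \<alpha>)" "form x y \<noteq> 0"
proof (rule ccontr)
  assume "\<not> thesis"
  with that have zero: "form x y = 0" if "y \<in> root_space (- \<alpha>)" for y
    using \<open>y \<in> root_space (- \<alpha>)\<close> by blast
  have "form x y = 0" if "\<beta> \<in> roots" "y \<in> root_space \<beta>" for \<beta> y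
  proof (cases "\<beta> = - \<alpha>")
    case True
    then show ?thesis using zero that by simp
  next
    case False
    then have "\<alpha> + \<beta> \<noteq> 0"
      by (metis add_eq_0_iff)
    then show ?thesis
      using root_spaces_orthogonal[OF assms(1) roots_in_dual assms(2)] that by blast
  qed
  then have "(\<Union>\<beta>\<in>roots. root_space \<beta>) \<subseteq> {y. form x y = 0}"
    by auto
  moreover have "subspace {y. form x y = 0}"
    by (auto simp: subspace_def form_zero_right form_add_right form_scale_right)
  ultimately have "UNIV \<subseteq> {y. form x y = 0}"
    unfolding root_space_sum[symmetric] by (rule span_minimal)
  then show False
    using form_nondegenerate[of x] assms(3) by blast
qed

lemma form_nondegenerate_on_H:
  assumes "x \<in> H" "\<And>h. h \<in> H \<Longrightarrow> form h x = 0"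
  shows "x = 0"
proof (rule ccontr)
  assume "x \<noteq> 0"
  then obtain y where "y \<in> root_space (- 0)" "form x y \<noteq> 0"
    using root_vector_pairing[OF dual_zero] assms(1) root_space_zero by blast
  then show False
    using assms(2) root_space_zero form_sym by (metis minus_zero)
qed

text \<open>
  The linear algebra fact behind this is that a functional vanishing on the common kernel of finitely many
  functionals, here \<open>h \<mapsto> form h b\<close> for \<open>b \<in> F\<close>, is a combination of them. Applied to a finite
  spanning set of \<open>H\<close>, it shows that \<open>t_elt\<close> is defined on all of \<open>dual\<close>.
\<close>

lemma functional_represented:
  assumes "finite F" "F \<subseteq> H" "\<alpha> \<in> dual"
    and "\<And>h. h \<in> H \<Longrightarrow> (\<And>b. b \<in> F \<Longrightarrow> form h b = 0) \<Longrightarrow> \<alpha> h = 0"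
  shows "\<exists>t\<in>H. \<forall>h\<in>H. \<alpha> h = form h t"
  using assms
proof (induction F arbitrary: \<alpha> rule: finite_induct)
  case empty
  then show ?case
    using subspace_0[OF subspace_H] by (auto simp: form_zero_right intro!: bexI[of _ 0])
next
  case (insert b F)
  show ?case
  proof (cases "\<exists>h0\<in>H. (\<forall>b'\<in>F. form h0 b' = 0) \<and> form h0 b \<noteq> 0")
    case True
    then obtain h0 where h0: "h0 \<in> H" "\<And>b'. b' \<in> F \<Longrightarrow> form h0 b' = 0" "form h0 b \<noteq> 0"
      by blast
    \<comment> \<open>Subtracting \<open>c\<close> times the functional of \<open>b\<close> makes \<open>\<alpha>\<close> vanish at \<open>h0\<close> as well.\<close>
    define c where "c = \<alpha> h0 / form h0 b"
    define \<alpha>' where "\<alpha>' = (\<lambda>x. if x \<in> H then \<alpha> x - c * form x b else 0)"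
    have "\<alpha>' \<in> dual"
      using insert.prems(2) subspace_add[OF subspace_H] subspace_scale[OF subspace_H]
      by (auto simp: dual_def \<alpha>'_def form_add_left form_scale_left algebra_simps)
    moreover have "\<alpha>' h = 0" if h: "h \<in> H" "\<And>b'. b' \<in> F \<Longrightarrow> form h b' = 0" for h
    proof -
      let ?r = "form h b / form h0 b"
      let ?h = "h - scale ?r h0"
      have "?h \<in> H"
        using h(1) h0(1) by (intro subspace_diff[OF subspace_H] subspace_scale[OF subspace_H])
      then have "\<alpha> ?h = 0"
        using h h0 by (intro insert.prems(3)) (auto simp: form_diff_left form_scale_left)
      moreover have "\<alpha> ?h = \<alpha> h - ?r * \<alpha> h0"
      proof -
        have "scale (- ?r) h0 \<in> H"
          using h0(1) by (rule subspace_scale[OF subspace_H])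
        then have "\<alpha> (h + scale (- ?r) h0) = \<alpha> h + \<alpha> (scale (- ?r) h0)"
          using insert.prems(2) h(1) unfolding dual_def by blast
        moreover have "\<alpha> (scale (- ?r) h0) = - ?r * \<alpha> h0"
          using insert.prems(2) h0(1) unfolding dual_def by blast
        ultimately show ?thesis
          by simp
      qed
      ultimately show ?thesis
        using h(1) h0(3) by (simp add: \<alpha>'_def c_def)
    qed
    ultimately obtain t where t: "t \<in> H" "\<And>h. h \<in> H \<Longrightarrow> \<alpha>' h = form h t"
      using insert.IH[of \<alpha>'] insert.prems(1) by blast
    have "t + scale c b \<in> H"
      using t(1) insert.prems(1) subspace_H by (auto intro: subspace_add subspace_scale)
    moreover have "\<alpha> h = form h (t + scale c b)" if "h \<in> H" for h
      using t(2)[OF that] that by (simp add: \<alpha>'_def form_add_right form_scale_right algebra_simps)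
    ultimately show ?thesis
      by blast
  next
    case False
    then have "\<alpha> h = 0" if "h \<in> H" "\<And>b'. b' \<in> F \<Longrightarrow> form h b' = 0" for h
      using insert.prems(3) that by blast
    then show ?thesis
      using insert.IH[of \<alpha>] insert.prems(1,2) by blast
  qed
qed

lemma ex1_t_elt:
  assumes "\<alpha> \<in> dual"
  shows "\<exists>!t. t \<in> H \<and> (\<forall>h\<in>H. \<alpha> h = form h t)"
proof -
  obtain B where B: "finite B" "H = span B"
    using H_finite_dim by blast
  have "\<alpha> h = 0" if h: "h \<in> H" "\<And>b. b \<in> B \<Longrightarrow> form h b = 0" for h
  proof -
    have "subspace {y. form h y = 0}"
      by (auto simp: subspace_def form_zero_right form_add_right form_scale_right)
    then have "H \<subseteq> {y. form h y = 0}"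
      using h(2) unfolding B(2) by (intro span_minimal) auto
    then have "h = 0"
      using form_nondegenerate_on_H[OF h(1)] form_sym by auto
    then show ?thesis
      using assms h(1) unfolding dual_def by (metis (mono_tags, lifting) mem_Collect_eq
          mult_zero_left scale_zero_left)
  qed
  moreover have "B \<subseteq> H"
    unfolding B(2) by (rule span_superset)
  ultimately obtain t where t: "t \<in> H" "\<forall>h\<in>H. \<alpha> h = form h t"
    using functional_represented[OF B(1) _ assms] by blast
  moreover have "s = t" if "s \<in> H" "\<forall>h\<in>H. \<alpha> h = form h s" for s
  proof -
    have "s - t = 0"
      using that t by (intro form_nondegenerate_on_H)
        (auto simp: form_diff_right subspace_diff[OF subspace_H])
    then show ?thesis by simp
  qed
  ultimately show ?thesis
    by blast
qed

lemma t_elt_in_H: "\<alpha> \<in> dual \<Longrightarrow> t_elt \<alpha> \<in> H"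
  and form_t_elt: "\<alpha> \<in> dual \<Longrightarrow> h \<in> H \<Longrightarrow> form h (t_elt \<alpha>) = \<alpha> h"
  using theI'[OF ex1_t_elt, of \<alpha>] unfolding t_elt_def by auto

lemma dual_form_eval: "\<alpha> \<in> dual \<Longrightarrow> \<beta> \<in> dual \<Longrightarrow> dual_form \<alpha> \<beta> = \<beta> (t_elt \<alpha>)"
  by (simp add: dual_form_def form_t_elt t_elt_in_H)

lemma dual_form_sym: "dual_form \<alpha> \<beta> = dual_form \<beta> \<alpha>"
  by (simp add: dual_form_def form_sym)

lemma dual_form_scale_right:
  "\<alpha> \<in> dual \<Longrightarrow> \<beta> \<in> dual \<Longrightarrow> dual_form \<alpha> (\<lambda>x. c * \<beta> x) = c * dual_form \<alpha> \<beta>"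
  by (simp add: dual_form_eval dual_scale)

lemma dual_form_minus_right:
  "\<alpha> \<in> dual \<Longrightarrow> \<beta> \<in> dual \<Longrightarrow> dual_form \<alpha> (- \<beta>) = - dual_form \<alpha> \<beta>"
  by (simp add: dual_form_eval dual_minus)

lemma dual_form_minus_left:
  "\<alpha> \<in> dual \<Longrightarrow> \<beta> \<in> dual \<Longrightarrow> dual_form (- \<alpha>) \<beta> = - dual_form \<alpha> \<beta>"
  using dual_form_minus_right dual_form_sym by metis

lemma dual_form_diff_right:
  "\<alpha> \<in> dual \<Longrightarrow> \<beta> \<in> dual \<Longrightarrow> \<gamma> \<in> dual \<Longrightarrow> dual_form \<alpha> (\<beta> - \<gamma>) = dual_form \<alpha> \<beta> - dual_form \<alpha> \<gamma>"
  by (simp add: dual_form_eval dual_diff)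

lemma bracket_opposite_root_vectors:
  assumes "\<alpha> \<in> dual" "x \<in> root_space \<alpha>" "y \<in> root_space (- \<alpha>)"
  shows "bracket x y = scale (form x y) (t_elt \<alpha>)"
proof -
  have H: "bracket x y \<in> H"
    using bracket_root_space[OF assms(2,3)] root_space_zero by simp
  have "bracket x y - scale (form x y) (t_elt \<alpha>) = 0"
  proof (rule form_nondegenerate_on_H)
    show "bracket x y - scale (form x y) (t_elt \<alpha>) \<in> H"
      using H t_elt_in_H[OF assms(1)]
      by (intro subspace_diff[OF subspace_H] subspace_scale[OF subspace_H])
    fix h assume h: "h \<in> H"
    then have "form h (bracket x y) = \<alpha> h * form x y"
      using assms(2) form_invariant[of h x y] by (simp add: root_space_def form_scale_left)
    then show "form h (bracket x y - scale (form x y) (t_elt \<alpha>)) = 0"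
      using form_t_elt[OF assms(1) h] by (simp add: form_diff_right form_scale_right)
  qed
  then show ?thesis
    by simp
qed

section \<open>Non-isotropic root spaces and reflections\<close>

abbreviation cartan_number :: "('e \<Rightarrow> complex) \<Rightarrow> ('e \<Rightarrow> complex) \<Rightarrow> complex" where
  "cartan_number \<alpha> \<beta> \<equiv> 2 * dual_form \<alpha> \<beta> / dual_form \<alpha> \<alpha>"

lemma minus_root:
  assumes "\<alpha> \<in> roots"
  shows "- \<alpha> \<in> roots"
proof -
  obtain x where "x \<in> root_space \<alpha>" "x \<noteq> 0"
    using assms by (rule root_vectorE)
  then obtain y where "y \<in> root_space (- \<alpha>)" "form x y \<noteq> 0"
    using root_vector_pairing roots_in_dual[OF assms] by metis
  then show ?thesis
    using rootI[of "- \<alpha>" y] dual_minus roots_in_dual[OF assms] form_zero_right by metis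
qed

lemma minus_nonisotropic:
  assumes "\<alpha> \<in> nonisotropic_roots"
  shows "- \<alpha> \<in> nonisotropic_roots"
  using assms minus_root nonisotropic_in_dual[OF assms]
  by (auto simp: nonisotropic_iff dual_form_minus_left dual_form_minus_right dual_minus)

lemma sl2_triple:
  assumes \<alpha>: "\<alpha> \<in> nonisotropic_roots" and e: "e \<in> root_space \<alpha>" "e \<noteq> 0"
  obtains f h where "f \<in> root_space (- \<alpha>)" "h \<in> H" "bracket e f = h" "form e f \<noteq> 0"
    "bracket h e = scale 2 e" "bracket h f = scale (- 2) f"
    "\<And>\<beta>. \<beta> \<in> dual \<Longrightarrow> \<beta> h = cartan_number \<alpha> \<beta>"
proof -
  note d = nonisotropic_in_dual[OF \<alpha>]
  have nz: "dual_form \<alpha> \<alpha> \<noteq> 0"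
    using \<alpha> by (simp add: nonisotropic_iff)
  obtain f0 where f0: "f0 \<in> root_space (- \<alpha>)" "form e f0 \<noteq> 0"
    using root_vector_pairing[OF d e] by blast
  \<comment> \<open>The scalar makes \<open>\<alpha>\<close> take the value \<open>2\<close> on \<open>[e, f]\<close>, as \<open>[e, f] = form e f * t_elt \<alpha>\<close>.\<close>
  define f where "f = scale (2 / (dual_form \<alpha> \<alpha> * form e f0)) f0"
  define h where "h = scale (2 / dual_form \<alpha> \<alpha>) (t_elt \<alpha>)"
  have f: "f \<in> root_space (- \<alpha>)"
    unfolding f_def using f0(1) by (rule subspace_scale[OF subspace_root_space])
  have ef: "form e f = 2 / dual_form \<alpha> \<alpha>"
    unfolding f_def using f0(2) by (simp add: form_scale_right)
  have h: "h \<in> H"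
    unfolding h_def using t_elt_in_H[OF d] by (rule subspace_scale[OF subspace_H])
  have val: "\<beta> h = cartan_number \<alpha> \<beta>" if "\<beta> \<in> dual" for \<beta>
  proof -
    have "\<beta> h = 2 / dual_form \<alpha> \<alpha> * \<beta> (t_elt \<alpha>)"
      using that t_elt_in_H[OF d] unfolding h_def dual_def by blast
    then show ?thesis
      using dual_form_eval[OF d that] by simp
  qed
  show ?thesis
  proof (rule that[OF f h])
    show "bracket e f = h"
      using bracket_opposite_root_vectors[OF d e(1) f] ef by (simp add: h_def)
    show "form e f \<noteq> 0"
      using ef nz by simp
    show "bracket h e = scale 2 e" "bracket h f = scale (- 2) f"
      using e(1) f h val[OF d] nz by (auto simp: root_space_def)
    show "\<And>\<beta>. \<beta> \<in> dual \<Longrightarrow> \<beta> h = cartan_number \<alpha> \<beta>"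
      by (rule val)
  qed
qed

text \<open>
  Every vector of the root space becomes orthogonal to \<open>f\<close> after a multiple of \<open>e\<close> is subtracted. It
  then commutes with \<open>f\<close>, so it is a lowest weight vector of the positive weight \<open>2\<close> on which \<open>e\<close> is
  nilpotent, hence zero.
\<close>

lemma nonisotropic_root_space_one_dimensional:
  assumes \<alpha>: "\<alpha> \<in> nonisotropic_roots" and e: "e \<in> root_space \<alpha>" "e \<noteq> 0" and x: "x \<in> root_space \<alpha>"
  shows "\<exists>c. x = scale c e"
proof -
  note d = nonisotropic_in_dual[OF \<alpha>]
  obtain f h where f: "f \<in> root_space (- \<alpha>)" "h \<in> H" "bracket e f = h" "form e f \<noteq> 0"
    "bracket h e = scale 2 e" "\<And>\<beta>. \<beta> \<in> dual \<Longrightarrow> \<beta> h = cartan_number \<alpha> \<beta>"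
    using sl2_triple[OF \<alpha> e] by metis
  define c where "c = form x f / form e f"
  define v where "v = x - scale c e"
  have v: "v \<in> root_space \<alpha>"
    unfolding v_def using x subspace_scale[OF subspace_root_space e(1)]
    by (rule subspace_diff[OF subspace_root_space])
  have "bracket v f = 0"
    using bracket_opposite_root_vectors[OF d v f(1)] f(4)
    by (simp add: v_def c_def form_diff_left form_scale_left)
  then have "bracket f v = 0"
    using bracket_antisym[of f v] by simp
  moreover have "bracket h v = scale 2 v"
    using v f(2) f(6)[OF d] \<alpha> by (simp add: root_space_def nonisotropic_iff)
  moreover obtain n where "(bracket e ^^ n) v = 0"
    using ad_locally_nilpotent[OF \<alpha> e(1)] by blast
  moreover have "2 + of_nat j \<noteq> (0 :: complex)" for j
    by (metis of_nat_add of_nat_eq_0_iff of_nat_numeral add_eq_0_iff_both_eq_0 zero_neq_numeral)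
  ultimately have "v = 0"
    using lowest_weight_vector_zero[OF f(5,3)] by blast
  then show ?thesis
    by (auto simp: v_def)
qed

lemma reflection_in_dual: "\<alpha> \<in> dual \<Longrightarrow> \<beta> \<in> dual \<Longrightarrow> reflection \<alpha> \<beta> \<in> dual"
  unfolding reflection_def by (intro dual_diff dual_scale)

lemma dual_form_reflection_right:
  assumes "\<alpha> \<in> dual" "\<beta> \<in> dual" "\<gamma> \<in> dual"
  shows "dual_form \<gamma> (reflection \<alpha> \<beta>) = dual_form \<gamma> \<beta> - cartan_number \<alpha> \<beta> * dual_form \<gamma> \<alpha>"
  unfolding reflection_def dual_form_diff_right[OF assms(3,2) dual_scale[OF assms(1)]]
    dual_form_scale_right[OF assms(3,1)] ..

lemma dual_form_reflection_self:
  assumes "\<alpha> \<in> dual" "\<beta> \<in> dual" "dual_form \<alpha> \<alpha> \<noteq> 0"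
  shows "dual_form (reflection \<alpha> \<beta>) (reflection \<alpha> \<beta>) = dual_form \<beta> \<beta>"
proof -
  note r = reflection_in_dual[OF assms(1,2)]
  have "dual_form \<alpha> (reflection \<alpha> \<beta>) = - dual_form \<alpha> \<beta>"
    using dual_form_reflection_right[OF assms(1,2,1)] assms(3) by simp
  then have "dual_form (reflection \<alpha> \<beta>) \<alpha> = - dual_form \<alpha> \<beta>"
    using dual_form_sym by metis
  moreover have "dual_form (reflection \<alpha> \<beta>) \<beta> = dual_form \<beta> \<beta> - cartan_number \<alpha> \<beta> * dual_form \<alpha> \<beta>"
    using dual_form_reflection_right[OF assms(1,2,2)] dual_form_sym by metis
  ultimately show ?thesis
    using dual_form_reflection_right[OF assms(1,2) r] by simp
qed

lemma reflection_involutive: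
  assumes "\<alpha> \<in> dual" "\<beta> \<in> dual" "dual_form \<alpha> \<alpha> \<noteq> 0"
  shows "reflection \<alpha> (reflection \<alpha> \<beta>) = \<beta>"
proof -
  have "dual_form \<alpha> (reflection \<alpha> \<beta>) = - dual_form \<alpha> \<beta>"
    using dual_form_reflection_right[OF assms(1,2,1)] assms(3) by simp
  then show ?thesis
    unfolding reflection_def[of \<alpha> "reflection \<alpha> \<beta>"]
    by (simp add: reflection_def fun_eq_iff)
qed

lemma reflection_by_minus:
  assumes "\<alpha> \<in> dual" "\<beta> \<in> dual"
  shows "reflection (- \<alpha>) \<beta> = reflection \<alpha> \<beta>"
  using assms
  by (simp add: reflection_def fun_eq_iff dual_form_minus_left dual_form_minus_right dual_minus)

text \<open>
  The reflected root is \<open>\<beta> + k \<alpha>\<close>, and \<open>x\<close> has weight \<open>- k\<close> for the triple of \<open>\<alpha>\<close>. This nonzero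
  vector serves twice: it shows that reflections permute the roots, and it carries eigenvectors of an
  automorphism from one root space to another.
\<close>

lemma raising_to_reflected_root_space:
  assumes \<alpha>: "\<alpha> \<in> nonisotropic_roots" and \<beta>: "\<beta> \<in> dual"
    and k: "cartan_number \<alpha> \<beta> = - of_nat k"
    and e: "e \<in> root_space \<alpha>" "e \<noteq> 0" and x: "x \<in> root_space \<beta>" "x \<noteq> 0"
  shows "(bracket e ^^ k) x \<in> root_space (reflection \<alpha> \<beta>)" "(bracket e ^^ k) x \<noteq> 0"
proof -
  have "reflection \<alpha> \<beta> = \<beta> + (\<lambda>z. of_nat k * \<alpha> z)"
    unfolding reflection_def k by (simp add: fun_eq_iff)
  then show "(bracket e ^^ k) x \<in> root_space (reflection \<alpha> \<beta>)"
    using ad_power_root_space[OF e(1) x(1)] by simp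
  obtain f h where f: "f \<in> root_space (- \<alpha>)" "h \<in> H" "bracket e f = h"
    "bracket h e = scale 2 e" "bracket h f = scale (- 2) f"
    "\<And>\<beta>. \<beta> \<in> dual \<Longrightarrow> \<beta> h = cartan_number \<alpha> \<beta>"
    using sl2_triple[OF \<alpha> e] by metis
  have "bracket h x = scale (- of_nat k) x"
    using x(1) f(2) f(6)[OF \<beta>] k by (simp add: root_space_def)
  moreover obtain m where "(bracket f ^^ m) x = 0"
    using ad_locally_nilpotent[OF minus_nonisotropic[OF \<alpha>] f(1)] by blast
  ultimately show "(bracket e ^^ k) x \<noteq> 0"
    using raising_power_injective[OF f(4,5,3)] x(2) by blast
qed

text \<open>
  One of \<open>\<alpha>\<close> and \<open>- \<alpha>\<close> has a Cartan number with \<open>\<beta>\<close> that is not positive, and both define the same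
  reflection.
\<close>

lemma reflection_nonisotropic:
  assumes \<alpha>: "\<alpha> \<in> nonisotropic_roots" and \<beta>: "\<beta> \<in> nonisotropic_roots"
    and int: "cartan_number \<alpha> \<beta> = of_int k"
  obtains \<epsilon> n where "\<epsilon> \<in> {\<alpha>, - \<alpha>}" "cartan_number \<epsilon> \<beta> = - of_nat n"
    "reflection \<epsilon> \<beta> = reflection \<alpha> \<beta>" "reflection \<alpha> \<beta> \<in> nonisotropic_roots"
proof -
  note d = nonisotropic_in_dual[OF \<alpha>] nonisotropic_in_dual[OF \<beta>]
  have ex: "\<exists>\<epsilon> n. \<epsilon> \<in> {\<alpha>, - \<alpha>} \<and> cartan_number \<epsilon> \<beta> = - of_nat n"
  proof (cases "k \<le> 0")
    case True
    then have "cartan_number \<alpha> \<beta> = - of_nat (nat (- k))"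
      using int by simp
    then show ?thesis by blast
  next
    case False
    then have "cartan_number (- \<alpha>) \<beta> = - of_nat (nat k)"
      using int d by (simp add: dual_form_minus_left dual_form_minus_right dual_minus)
    then show ?thesis by blast
  qed
  then obtain \<epsilon> n where \<epsilon>: "\<epsilon> \<in> {\<alpha>, - \<alpha>}" "cartan_number \<epsilon> \<beta> = - of_nat n"
    by blast
  have eq: "reflection \<epsilon> \<beta> = reflection \<alpha> \<beta>"
    using \<epsilon>(1) reflection_by_minus[OF d] by auto
  have ni: "\<epsilon> \<in> nonisotropic_roots"
    using \<epsilon>(1) \<alpha> minus_nonisotropic by auto
  obtain e where e: "e \<in> root_space \<epsilon>" "e \<noteq> 0"
    using nonisotropic_in_roots[OF ni] by (rule root_vectorE)
  obtain x where x: "x \<in> root_space \<beta>" "x \<noteq> 0"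
    using nonisotropic_in_roots[OF \<beta>] by (rule root_vectorE)
  have "reflection \<epsilon> \<beta> \<in> roots"
    using rootI[OF reflection_in_dual[OF nonisotropic_in_dual[OF ni] d(2)]]
      raising_to_reflected_root_space[OF ni d(2) \<epsilon>(2) e x] by blast
  then have "reflection \<alpha> \<beta> \<in> nonisotropic_roots"
    using eq dual_form_reflection_self[OF d] \<alpha> \<beta> by (simp add: nonisotropic_iff)
  then show ?thesis
    by (rule that[OF \<epsilon> eq])
qed

section \<open>The group generated by reflections\<close>

lemma reflection_in_Bij:
  assumes "\<alpha> \<in> nonisotropic_roots"
  shows "restrict (reflection \<alpha>) dual \<in> Bij dual"
proof -
  note d = nonisotropic_in_dual[OF assms]
  have nz: "dual_form \<alpha> \<alpha> \<noteq> 0"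
    using assms by (simp add: nonisotropic_iff)
  have "bij_betw (reflection \<alpha>) dual dual"
    by (rule bij_betwI[where g = "reflection \<alpha>"])
      (auto simp: reflection_in_dual[OF d] reflection_involutive[OF d _ nz])
  then show ?thesis
    by (simp add: Bij_def)
qed

lemma reflection_inverse:
  assumes "\<alpha> \<in> nonisotropic_roots"
  shows "inv\<^bsub>BijGroup dual\<^esub> (restrict (reflection \<alpha>) dual) = restrict (reflection \<alpha>) dual"
proof -
  note d = nonisotropic_in_dual[OF assms]
  have nz: "dual_form \<alpha> \<alpha> \<noteq> 0"
    using assms by (simp add: nonisotropic_iff)
  let ?r = "restrict (reflection \<alpha>) dual"
  have "compose dual ?r ?r = (\<lambda>x\<in>dual. x)"
    by (auto simp: compose_def reflection_in_dual[OF d] reflection_involutive[OF d _ nz])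
  then have "?r \<otimes>\<^bsub>BijGroup dual\<^esub> ?r = \<one>\<^bsub>BijGroup dual\<^esub>"
    using reflection_in_Bij[OF assms] by (simp add: BijGroup_def)
  moreover have "?r \<in> carrier (BijGroup dual)"
    using reflection_in_Bij[OF assms] by (simp add: BijGroup_def)
  ultimately show ?thesis
    using group.inv_equality[OF group_BijGroup] by blast
qed

lemma reflection_group_in_Bij:
  assumes "P \<subseteq> nonisotropic_roots" "w \<in> reflection_group P"
  shows "w \<in> Bij dual"
proof -
  have "(\<lambda>\<alpha>. restrict (reflection \<alpha>) dual) ` P \<subseteq> carrier (BijGroup dual)"
    using assms(1) reflection_in_Bij by (auto simp: BijGroup_def)
  then have "w \<in> carrier (BijGroup dual)"
    using group.generate_in_carrier[OF group_BijGroup] assms(2) unfolding reflection_group_def by blast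
  then show ?thesis
    by (simp add: BijGroup_def)
qed

text \<open>
  Closure under the generators suffices because a reflection is its own inverse.
\<close>

lemma reflection_group_preserves:
  assumes P: "P \<subseteq> nonisotropic_roots" and N: "N \<subseteq> dual"
    and closed: "\<And>\<gamma> \<beta>. \<gamma> \<in> P \<Longrightarrow> \<beta> \<in> N \<Longrightarrow> reflection \<gamma> \<beta> \<in> N"
    and w: "w \<in> reflection_group P" and \<beta>: "\<beta> \<in> N"
  shows "w \<beta> \<in> N"
  using w[unfolded reflection_group_def] \<beta>
proof (induction arbitrary: \<beta> rule: generate.induct)
  case one
  then show ?case
    using N by (auto simp: BijGroup_def)
next
  case (incl h)
  then show ?case
    using closed N by auto
next
  case (inv h)
  then obtain \<gamma> where \<gamma>: "\<gamma> \<in> P" "h = restrict (reflection \<gamma>) dual"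
    by blast
  have "inv\<^bsub>BijGroup dual\<^esub> h = h"
    unfolding \<gamma>(2) using \<gamma>(1) P by (intro reflection_inverse) blast
  then show ?case
    using closed[OF \<gamma>(1) inv.prems] inv.prems N \<gamma>(2) by auto
next
  case (eng h1 h2)
  have "h1 \<in> Bij dual" "h2 \<in> Bij dual"
    using eng.hyps reflection_group_in_Bij[OF P] unfolding reflection_group_def by blast+
  then show ?case
    using eng N by (auto simp: BijGroup_def compose_def)
qed

definition orbit :: "('e \<Rightarrow> complex) set \<Rightarrow> ('e \<Rightarrow> complex) set" where
  "orbit P = {w \<alpha> | w \<alpha>. w \<in> reflection_group P \<and> \<alpha> \<in> P}"

lemma generates_roots_iff: "generates_roots P \<longleftrightarrow> orbit P = nonisotropic_roots"
  by (simp add: generates_roots_def orbit_def)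

lemma orbit_subset:
  assumes "P \<subseteq> nonisotropic_roots" "N \<subseteq> dual" "P \<subseteq> N"
    and "\<And>\<gamma> \<beta>. \<gamma> \<in> P \<Longrightarrow> \<beta> \<in> N \<Longrightarrow> reflection \<gamma> \<beta> \<in> N"
  shows "orbit P \<subseteq> N"
proof
  fix \<beta> assume "\<beta> \<in> orbit P"
  then obtain w \<alpha> where w: "w \<in> reflection_group P" "\<alpha> \<in> P" "\<beta> = w \<alpha>"
    unfolding orbit_def by blast
  show "\<beta> \<in> N"
    unfolding w(3) using reflection_group_preserves[OF assms(1,2,4) w(1)] w(2) assms(3) by blast
qed

lemma subset_orbit:
  assumes "P \<subseteq> nonisotropic_roots"
  shows "P \<subseteq> orbit P"
proof
  fix \<alpha> assume "\<alpha> \<in> P"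
  moreover have "(\<lambda>x\<in>dual. x) \<in> reflection_group P"
    using generate.one[of "BijGroup dual"] unfolding reflection_group_def by (simp add: BijGroup_def)
  ultimately have "(\<lambda>x\<in>dual. x) \<alpha> \<in> orbit P"
    unfolding orbit_def by blast
  then show "\<alpha> \<in> orbit P"
    using \<open>\<alpha> \<in> P\<close> assms nonisotropic_in_dual by auto
qed

lemma orbit_reflection_closed:
  assumes P: "P \<subseteq> nonisotropic_roots" and "\<gamma> \<in> P" "\<beta> \<in> orbit P"
  shows "reflection \<gamma> \<beta> \<in> orbit P"
proof -
  obtain w \<alpha> where w: "w \<in> reflection_group P" "\<alpha> \<in> P" "\<beta> = w \<alpha>"
    using assms(3) unfolding orbit_def by blast
  let ?r = "restrict (reflection \<gamma>) dual"
  have bij: "?r \<in> Bij dual" "w \<in> Bij dual"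
    using assms reflection_in_Bij reflection_group_in_Bij[OF P w(1)] by auto
  have \<alpha>: "\<alpha> \<in> dual"
    using w(2) P nonisotropic_in_dual by blast
  then have "w \<alpha> \<in> dual"
    using Bij_imp_funcset[OF bij(2)] by blast
  have "?r \<otimes>\<^bsub>BijGroup dual\<^esub> w \<in> reflection_group P"
    using w(1) assms(2) unfolding reflection_group_def by (auto intro: generate.incl generate.eng)
  moreover have "?r \<otimes>\<^bsub>BijGroup dual\<^esub> w = compose dual ?r w"
    using bij by (simp add: BijGroup_def)
  ultimately have "compose dual ?r w \<alpha> \<in> orbit P"
    using w(2) unfolding orbit_def by auto
  then show ?thesis
    using \<alpha> \<open>w \<alpha> \<in> dual\<close> by (simp add: compose_def w(3))
qed

end

section \<open>Finiteness of reflectable bases\<close>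

text \<open>
  The map \<open>cls\<close> stands for the projection to the quotient by the isotropic span, composed with any
  coordinates there. Cartan numbers are computed in the quotient, which is a finite root system: they
  are integers, and equal to \<open>2\<close> for two roots with the same projection.
\<close>

locale eala_with_finite_quotient = extended_affine_lie_algebra scale bracket form H
  for scale :: "complex \<Rightarrow> 'e::ab_group_add \<Rightarrow> 'e" and bracket form H +
  fixes cls :: "('e \<Rightarrow> complex) \<Rightarrow> 'b::ab_group_add"
  assumes cls_add: "\<alpha> \<in> root_span \<Longrightarrow> \<beta> \<in> root_span \<Longrightarrow> cls (\<alpha> + \<beta>) = cls \<alpha> + cls \<beta>"
    and cls_isotropic: "\<sigma> \<in> isotropic_roots \<Longrightarrow> cls \<sigma> = 0"
    and cls_nonisotropic: "\<alpha> \<in> nonisotropic_roots \<Longrightarrow> cls \<alpha> \<noteq> 0"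
    and finite_cls: "finite (cls ` nonisotropic_roots)"
    and cartan_integer:
      "\<alpha> \<in> nonisotropic_roots \<Longrightarrow> \<beta> \<in> nonisotropic_roots \<Longrightarrow> \<exists>k. cartan_number \<alpha> \<beta> = of_int k"
    and cartan_same_cls:
      "\<alpha> \<in> nonisotropic_roots \<Longrightarrow> \<beta> \<in> nonisotropic_roots \<Longrightarrow> cls \<alpha> = cls \<beta> \<Longrightarrow> cartan_number \<alpha> \<beta> = 2"
begin

lemma reflection_closed:
  assumes "\<alpha> \<in> nonisotropic_roots" "\<beta> \<in> nonisotropic_roots"
  shows "reflection \<alpha> \<beta> \<in> nonisotropic_roots"
  using cartan_integer[OF assms] reflection_nonisotropic[OF assms] by metis

lemma nonisotropic_in_root_span: "\<alpha> \<in> nonisotropic_roots \<Longrightarrow> \<alpha> \<in> root_span"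
  unfolding root_span_def by (intro real_fun.span_base nonisotropic_in_roots)

definition fibre :: "'b \<Rightarrow> ('e \<Rightarrow> complex) set" where
  "fibre a = {\<alpha> \<in> nonisotropic_roots. cls \<alpha> = a}"

text \<open>
  Two reflections in roots with the same class compose to a translation on the roots of that class.
\<close>

lemma double_reflection_in_fibre:
  assumes "\<alpha> \<in> fibre a" "\<alpha>' \<in> fibre a" "\<beta> \<in> fibre a"
  shows "reflection \<alpha>' (reflection \<alpha> \<beta>) = \<beta> + (\<alpha>' - \<alpha>) + (\<alpha>' - \<alpha>)"
    and "\<beta> + (\<alpha>' - \<alpha>) + (\<alpha>' - \<alpha>) \<in> fibre a"
proof -
  have ni: "\<alpha> \<in> nonisotropic_roots" "\<alpha>' \<in> nonisotropic_roots" "\<beta> \<in> nonisotropic_roots"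
    and cls: "cls \<alpha> = a" "cls \<alpha>' = a" "cls \<beta> = a"
    using assms by (auto simp: fibre_def)
  note d = ni[THEN nonisotropic_in_dual]
  have c: "cartan_number \<alpha> \<beta> = 2" "cartan_number \<alpha>' \<beta> = 2" "cartan_number \<alpha>' \<alpha> = 2"
    using cartan_same_cls ni cls by auto
  have nz: "dual_form \<alpha>' \<alpha>' \<noteq> 0"
    using ni(2) by (simp add: nonisotropic_iff)
  have "dual_form \<alpha>' (reflection \<alpha> \<beta>) = dual_form \<alpha>' \<beta> - 2 * dual_form \<alpha>' \<alpha>"
    using dual_form_reflection_right[OF d(1,3,2)] c(1) by simp
  then have "cartan_number \<alpha>' (reflection \<alpha> \<beta>) = cartan_number \<alpha>' \<beta> - 2 * cartan_number \<alpha>' \<alpha>"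
    by (simp add: diff_divide_distrib right_diff_distrib)
  then have "cartan_number \<alpha>' (reflection \<alpha> \<beta>) = - 2"
    unfolding c by simp
  then show eq: "reflection \<alpha>' (reflection \<alpha> \<beta>) = \<beta> + (\<alpha>' - \<alpha>) + (\<alpha>' - \<alpha>)"
    unfolding reflection_def[of \<alpha>'] unfolding reflection_def c(1)
    by (simp add: fun_eq_iff)
  let ?\<gamma> = "\<beta> + (\<alpha>' - \<alpha>) + (\<alpha>' - \<alpha>)"
  have \<gamma>: "?\<gamma> \<in> nonisotropic_roots"
    unfolding eq[symmetric] using ni by (intro reflection_closed)
  note s = ni[THEN nonisotropic_in_root_span] \<gamma>[THEN nonisotropic_in_root_span]
  have add: "x + y \<in> root_span" if "x \<in> root_span" "y \<in> root_span" for x y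
    using that unfolding root_span_def by (rule real_fun.span_add)
  have "cls (?\<gamma> + (\<alpha> + \<alpha>)) = cls ?\<gamma> + (a + a)"
    using s cls by (simp only: cls_add add)
  moreover have "?\<gamma> + (\<alpha> + \<alpha>) = \<beta> + (\<alpha>' + \<alpha>')"
    by simp
  moreover have "cls (\<beta> + (\<alpha>' + \<alpha>')) = a + (a + a)"
    using s cls by (simp only: cls_add add)
  ultimately have "cls ?\<gamma> + (a + a) = a + (a + a)"
    by (simp only:)
  then have "cls ?\<gamma> = a"
    by (rule add_right_imp_eq)
  with \<gamma> show "?\<gamma> \<in> fibre a"
    by (simp add: fibre_def)
qed

text \<open>
  The admissible translations form a group, which contains the generators by the preceding lemma.
\<close>

lemma translations_preserve_orbit_in_fibre:
  assumes P: "P \<subseteq> nonisotropic_roots" and \<alpha>0: "\<alpha>0 \<in> P \<inter> fibre a" and F: "F \<subseteq> P \<inter> fibre a"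
    and \<tau>: "\<tau> \<in> int_fun.span ((\<lambda>\<alpha>. \<alpha> - \<alpha>0) ` F)" and \<beta>: "\<beta> \<in> orbit P \<inter> fibre a"
  shows "\<beta> + \<tau> + \<tau> \<in> orbit P \<inter> fibre a"
proof -
  define O' where "O' = orbit P \<inter> fibre a"
  define T where "T = {\<tau>. \<forall>\<beta>\<in>O'. \<beta> + \<tau> + \<tau> \<in> O' \<and> \<beta> + (- \<tau>) + (- \<tau>) \<in> O'}"
  have add: "\<sigma> + \<tau> \<in> T" if "\<sigma> \<in> T" "\<tau> \<in> T" for \<sigma> \<tau>
  proof -
    have "\<beta> + (\<sigma> + \<tau>) + (\<sigma> + \<tau>) \<in> O'" "\<beta> + (- (\<sigma> + \<tau>)) + (- (\<sigma> + \<tau>)) \<in> O'" if "\<beta> \<in> O'" for \<beta>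
    proof -
      have "(\<beta> + \<sigma> + \<sigma>) + \<tau> + \<tau> \<in> O'" "(\<beta> + (- \<sigma>) + (- \<sigma>)) + (- \<tau>) + (- \<tau>) \<in> O'"
        using that \<open>\<sigma> \<in> T\<close> \<open>\<tau> \<in> T\<close> unfolding T_def by blast+
      then show "\<beta> + (\<sigma> + \<tau>) + (\<sigma> + \<tau>) \<in> O'" "\<beta> + (- (\<sigma> + \<tau>)) + (- (\<sigma> + \<tau>)) \<in> O'"
        by (simp_all only: minus_add_distrib add_ac)
    qed
    then show ?thesis
      unfolding T_def by blast
  qed
  have zero: "0 \<in> T"
    by (simp add: T_def)
  have neg: "- \<tau> \<in> T" if "\<tau> \<in> T" for \<tau>
    using that unfolding T_def mem_Collect_eq minus_minus by blast
  have nat_mult: "zscale (int n) \<tau> \<in> T" if "\<tau> \<in> T" for n \<tau>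
  proof (induction n)
    case 0
    then show ?case using zero by (simp add: zero_fun_def)
  next
    case (Suc n)
    have "zscale (int (Suc n)) \<tau> = zscale (int n) \<tau> + \<tau>"
      by (simp add: zscale_def fun_eq_iff algebra_simps)
    then show ?case
      using add[OF Suc that] by (simp only:)
  qed
  have mult: "zscale k \<tau> \<in> T" if "\<tau> \<in> T" for k \<tau>
  proof (cases "k \<ge> 0")
    case True
    then show ?thesis
      using nat_mult[OF that, of "nat k"] by simp
  next
    case False
    then have "zscale k \<tau> = - zscale (int (nat (- k))) \<tau>"
      by simp
    then show ?thesis
      using neg[OF nat_mult[OF that, of "nat (- k)"]] by simp
  qed
  have base: "\<alpha> - \<alpha>0 \<in> T" if \<alpha>: "\<alpha> \<in> F" for \<alpha>
  proof -
    have "\<beta> + (\<alpha> - \<alpha>0) + (\<alpha> - \<alpha>0) \<in> O' \<and> \<beta> + (- (\<alpha> - \<alpha>0)) + (- (\<alpha> - \<alpha>0)) \<in> O'" if "\<beta> \<in> O'" for \<beta>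
    proof -
      have \<beta>: "\<beta> \<in> orbit P" "\<beta> \<in> fibre a"
        using that by (auto simp: O'_def)
      have in_P: "\<alpha> \<in> P" "\<alpha>0 \<in> P" "\<alpha> \<in> fibre a" "\<alpha>0 \<in> fibre a"
        using \<alpha> F \<alpha>0 by auto
      have "reflection \<alpha> (reflection \<alpha>0 \<beta>) \<in> orbit P" "reflection \<alpha>0 (reflection \<alpha> \<beta>) \<in> orbit P"
        using in_P \<beta>(1) by (simp_all add: orbit_reflection_closed[OF P])
      then show ?thesis
        using double_reflection_in_fibre[OF in_P(4,3) \<beta>(2)] double_reflection_in_fibre[OF in_P(3,4) \<beta>(2)]
        by (simp add: O'_def minus_diff_eq)
    qed
    then show ?thesis
      unfolding T_def by blast
  qed
  have "int_fun.subspace T"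
    unfolding int_fun.subspace_def using zero add mult by blast
  then have "int_fun.span ((\<lambda>\<alpha>. \<alpha> - \<alpha>0) ` F) \<subseteq> T"
    using base by (intro int_fun.span_minimal) auto
  then show ?thesis
    using \<tau> \<beta> unfolding T_def O'_def by blast
qed

text \<open>
  The differences of roots in a fibre generate a finitely generated group \<open>T\<close>. A finite part \<open>F\<close> of
  the fibre whose differences generate \<open>T\<close> yields all translations by \<open>2 T\<close>, and the fibre meets only
  finitely many cosets of \<open>2 T\<close>, so a finite set \<open>G\<close> of representatives completes \<open>F\<close>.
\<close>

lemma finitely_many_reflections_cover_fibre:
  "\<exists>F. finite F \<and> F \<subseteq> fibre a \<and> (\<forall>P. F \<subseteq> P \<longrightarrow> P \<subseteq> nonisotropic_roots \<longrightarrow> fibre a \<subseteq> orbit P)"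
proof (cases "fibre a = {}")
  case True
  then show ?thesis by blast
next
  case False
  then obtain \<alpha>0 where \<alpha>0: "\<alpha>0 \<in> fibre a"
    by blast
  define d where "d = (\<lambda>\<alpha>. \<alpha> - \<alpha>0)"
  obtain B where B: "finite B" "int_fun.span B = int_fun.span roots"
    using root_lattice_free unfolding finite_int_basis_def by blast
  have "fibre a \<subseteq> int_fun.span roots"
    using int_fun.span_superset nonisotropic_in_roots by (fastforce simp: fibre_def)
  then have "d ` fibre a \<subseteq> int_fun.span B"
    unfolding B(2) d_def using \<alpha>0 by (auto intro: int_fun.span_diff)
  then obtain F0 where F0: "finite F0" "F0 \<subseteq> d ` fibre a"
    "int_fun.span F0 = int_fun.span (d ` fibre a)"
    using finite_generating_subset[OF B(1)] by metis
  then obtain F where F: "F \<subseteq> fibre a" "finite F" "F0 = d ` F"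
    by (metis finite_subset_image)
  have "\<exists>u. d \<beta> = (\<Sum>f\<in>F0. zscale (u f) f)" if "\<beta> \<in> fibre a" for \<beta>
  proof -
    have "d \<beta> \<in> int_fun.span F0"
      unfolding F0(3) using that by (intro int_fun.span_base) auto
    then show ?thesis
      unfolding int_fun.span_finite[OF F0(1)] by blast
  qed
  then obtain u where u: "\<And>\<beta>. \<beta> \<in> fibre a \<Longrightarrow> d \<beta> = (\<Sum>f\<in>F0. zscale (u \<beta> f) f)"
    by metis
  define parity where "parity \<beta> = {f \<in> F0. odd (u \<beta> f)}" for \<beta>
  have "finite (parity ` fibre a)"
    by (rule finite_subset[of _ "Pow F0"]) (auto simp: parity_def F0(1))
  then obtain G where G: "G \<subseteq> fibre a" "finite G" "parity ` fibre a = parity ` G"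
    by (metis finite_subset_image subset_refl)
  let ?F = "insert \<alpha>0 F \<union> G"
  have "fibre a \<subseteq> orbit P" if P: "?F \<subseteq> P" "P \<subseteq> nonisotropic_roots" for P
  proof
    fix \<beta> assume \<beta>: "\<beta> \<in> fibre a"
    then obtain \<gamma> where \<gamma>: "\<gamma> \<in> G" "parity \<gamma> = parity \<beta>"
      using G(3) by (metis imageE imageI)
    \<comment> \<open>Equal parities make the difference of \<open>\<beta>\<close> and \<open>\<gamma>\<close> twice an element of the group.\<close>
    define \<tau> where "\<tau> = (\<Sum>f\<in>F0. zscale ((u \<beta> f - u \<gamma> f) div 2) f)"
    have even: "even (u \<beta> f - u \<gamma> f)" if "f \<in> F0" for f
      using that \<gamma>(2) by (auto simp: parity_def set_eq_iff)
    have "\<tau> + \<tau> = (\<Sum>f\<in>F0. zscale (u \<beta> f - u \<gamma> f) f)"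
      unfolding \<tau>_def sum.distrib[symmetric]
    proof (intro sum.cong refl)
      fix f assume "f \<in> F0"
      then have "u \<beta> f - u \<gamma> f = (u \<beta> f - u \<gamma> f) div 2 + (u \<beta> f - u \<gamma> f) div 2"
        using even by fastforce
      then show "zscale ((u \<beta> f - u \<gamma> f) div 2) f + zscale ((u \<beta> f - u \<gamma> f) div 2) f
          = zscale (u \<beta> f - u \<gamma> f) f"
        by (metis int_fun.scale_left_distrib)
    qed
    also have "\<dots> = d \<beta> - d \<gamma>"
      using u[OF \<beta>] u[of \<gamma>] \<gamma>(1) G(1)
      by (auto simp: int_fun.scale_left_diff_distrib sum_subtractf)
    finally have \<tau>: "\<gamma> + \<tau> + \<tau> = \<beta>"
      by (simp add: d_def add.assoc)
    have "\<tau> \<in> int_fun.span ((\<lambda>\<alpha>. \<alpha> - \<alpha>0) ` F)"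
      unfolding \<tau>_def F(3)[unfolded d_def]
      by (intro int_fun.span_sum int_fun.span_scale int_fun.span_base)
    moreover have "\<gamma> \<in> orbit P \<inter> fibre a"
      using \<gamma>(1) G(1) P subset_orbit by blast
    ultimately have "\<gamma> + \<tau> + \<tau> \<in> orbit P \<inter> fibre a"
      using P F(1) \<alpha>0 by (intro translations_preserve_orbit_in_fibre[of P \<alpha>0 a F]) auto
    then show "\<beta> \<in> orbit P"
      unfolding \<tau> by blast
  qed
  then show ?thesis
    using \<alpha>0 F(1,2) G(1,2) by (intro exI[of _ ?F]) auto
qed

lemma finite_generating_set_exists:
  obtains P where "finite P" "P \<subseteq> nonisotropic_roots" "generates_roots P"
proof -
  obtain F where F: "\<And>a. finite (F a)" "\<And>a. F a \<subseteq> fibre a"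
    "\<And>a P. F a \<subseteq> P \<Longrightarrow> P \<subseteq> nonisotropic_roots \<Longrightarrow> fibre a \<subseteq> orbit P"
    using finitely_many_reflections_cover_fibre by metis
  define P where "P = (\<Union>a\<in>cls ` nonisotropic_roots. F a)"
  have P: "P \<subseteq> nonisotropic_roots"
    using F(2) by (auto simp: P_def fibre_def)
  have "nonisotropic_roots \<subseteq> orbit P"
  proof
    fix \<alpha> assume \<alpha>: "\<alpha> \<in> nonisotropic_roots"
    then have "fibre (cls \<alpha>) \<subseteq> orbit P"
      by (intro F(3)[OF _ P]) (auto simp: P_def)
    with \<alpha> show "\<alpha> \<in> orbit P"
      by (auto simp: fibre_def)
  qed
  moreover have "orbit P \<subseteq> nonisotropic_roots"
    using P reflection_closed nonisotropic_in_dual by (intro orbit_subset) auto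
  ultimately have "generates_roots P"
    by (auto simp: generates_roots_iff)
  moreover have "finite P"
    unfolding P_def using finite_cls F(1) by (rule finite_UN_I)
  ultimately show ?thesis
    using that P by blast
qed

text \<open>
  A minimal generating subset of a finite generating set is a reflectable base, so the minimum that
  defines \<open>refl_number\<close> is taken over a nonempty set.
\<close>

lemma refl_number_attained:
  obtains P where "reflectable_base P" "finite P" "card P = refl_number"
proof -
  obtain P where P: "finite P" "P \<subseteq> nonisotropic_roots" "generates_roots P"
    by (rule finite_generating_set_exists)
  let ?A = "{Q. Q \<subseteq> P \<and> generates_roots Q}"
  have "finite ?A" "?A \<noteq> {}"
    using P by auto
  from finite_has_minimal[OF this]
  obtain Q where Q: "Q \<in> ?A" "\<And>Q'. Q' \<in> ?A \<Longrightarrow> Q' \<subseteq> Q \<Longrightarrow> Q = Q'"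
    by (elim bexE) auto
  have "\<not> generates_roots Q'" if "Q' \<subset> Q" for Q'
    using that Q(1) Q(2)[of Q'] by auto
  then have "reflectable_base Q" "finite Q"
    using Q(1) P(1,2) finite_subset[OF _ P(1)] unfolding reflectable_base_def by auto
  then have "\<exists>n Q. reflectable_base Q \<and> finite Q \<and> card Q = n"
    by blast
  from LeastI_ex[OF this] show ?thesis
    using that unfolding refl_number_def by blast
qed

section \<open>The root lattice is spanned by a reflectable base\<close>

lemma nonisotropic_in_int_span:
  assumes "P \<subseteq> nonisotropic_roots" "generates_roots P"
  shows "nonisotropic_roots \<subseteq> int_fun.span P"
proof -
  let ?N = "nonisotropic_roots \<inter> int_fun.span P"
  have "orbit P \<subseteq> ?N"
  proof (rule orbit_subset[OF assms(1)])
    show "?N \<subseteq> dual" "P \<subseteq> ?N"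
      using assms(1) nonisotropic_in_dual int_fun.span_superset by auto
    fix \<gamma> \<beta> assume *: "\<gamma> \<in> P" "\<beta> \<in> ?N"
    then obtain k where "cartan_number \<gamma> \<beta> = of_int k"
      using cartan_integer assms(1) by blast
    then have "reflection \<gamma> \<beta> = \<beta> - zscale k \<gamma>"
      by (simp add: reflection_def zscale_def)
    moreover have "\<beta> - zscale k \<gamma> \<in> int_fun.span P"
      using * by (intro int_fun.span_diff int_fun.span_scale) (auto intro: int_fun.span_base)
    moreover have "reflection \<gamma> \<beta> \<in> nonisotropic_roots"
      using * assms(1) by (intro reflection_closed) auto
    ultimately show "reflection \<gamma> \<beta> \<in> ?N"
      by simp
  qed
  then show ?thesis
    using assms(2) by (auto simp: generates_roots_iff)
qed

text \<open>
  Adding an isotropic root does not change the class, and isotropic roots have class \<open>0\<close>.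
\<close>

lemma isotropic_shift_nonisotropic:
  assumes "\<sigma> \<in> isotropic_roots" "\<alpha> \<in> nonisotropic_roots" "\<alpha> + \<sigma> \<in> roots"
  shows "\<alpha> + \<sigma> \<in> nonisotropic_roots"
proof (rule ccontr)
  assume "\<not> ?thesis"
  then have "cls (\<alpha> + \<sigma>) = 0"
    using assms(3) cls_isotropic by (simp add: nonisotropic_roots_def)
  moreover have "\<sigma> \<in> root_span"
    using assms(1) unfolding root_span_def isotropic_roots_def by (auto intro: real_fun.span_base)
  ultimately show False
    using cls_add[OF nonisotropic_in_root_span[OF assms(2)]] cls_isotropic[OF assms(1)]
      cls_nonisotropic[OF assms(2)] by simp
qed

lemma span_subalgebra:
  assumes "\<And>x y. x \<in> G \<Longrightarrow> y \<in> G \<Longrightarrow> bracket x y \<in> span G"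
  shows "subalgebra (span G)"
proof -
  have 1: "bracket x y \<in> span G" if "x \<in> G" "y \<in> span G" for x y
  proof -
    have "subspace {y. bracket x y \<in> span G}"
      by (auto simp: subspace_def bracket_zero_right bracket_add_right bracket_scale_right
          span_zero span_add span_scale)
    then have "span G \<subseteq> {y. bracket x y \<in> span G}"
      using assms that(1) by (intro span_minimal) auto
    then show ?thesis
      using that(2) by blast
  qed
  have "bracket x y \<in> span G" if "x \<in> span G" "y \<in> span G" for x y
  proof -
    have "subspace {x. bracket x y \<in> span G}"
      by (auto simp: subspace_def bracket_zero_left bracket_add_left bracket_scale_left
          span_zero span_add span_scale)
    then have "span G \<subseteq> {x. bracket x y \<in> span G}"
      using 1 that(2) by (intro span_minimal) auto
    then show ?thesis
      using that(1) by blast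
  qed
  then show ?thesis
    by (simp add: subalgebra_def)
qed

lemma core_subset:
  assumes "subalgebra K" "\<And>\<alpha>. \<alpha> \<in> nonisotropic_roots \<Longrightarrow> root_space \<alpha> \<subseteq> K"
  shows "core \<subseteq> K"
  unfolding core_def using assms by (intro hull_minimal) auto

text \<open>
  The elements that commute with \<open>y\<close> form a subalgebra, so \<open>y\<close> centralizes the core as soon as it
  centralizes the generators; tameness then applies.
\<close>

lemma centralizer_in_core:
  assumes "\<And>\<alpha> z. \<alpha> \<in> nonisotropic_roots \<Longrightarrow> z \<in> root_space \<alpha> \<Longrightarrow> bracket y z = 0"
  shows "y \<in> core"
proof -
  have "subalgebra {z. bracket y z = 0}"
    by (simp add: subalgebra_def subspace_kernel_ad bracket_derivation[of y] bracket_zero_left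
        bracket_zero_right)
  then have "core \<subseteq> {z. bracket y z = 0}"
    using assms by (intro core_subset) auto
  then show ?thesis
    using tame by blast
qed

lemma span_of_weight_subspaces:
  assumes "x \<in> span (\<Union>\<mu>\<in>L. V \<mu>)" "\<And>\<mu>. \<mu> \<in> L \<Longrightarrow> subspace (V \<mu>)"
  shows "\<exists>F y. finite F \<and> F \<subseteq> L \<and> (\<forall>\<mu>\<in>F. y \<mu> \<in> V \<mu>) \<and> x = (\<Sum>\<mu>\<in>F. y \<mu>)"
  using assms(1)
proof (induction rule: span_induct_alt)
  case base
  show ?case
    by (intro exI[of _ "{}"]) auto
next
  case (step c v w)
  then obtain \<nu> F y where *: "\<nu> \<in> L" "v \<in> V \<nu>" "finite F" "F \<subseteq> L" "\<And>\<mu>. \<mu> \<in> F \<Longrightarrow> y \<mu> \<in> V \<mu>"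
    "w = (\<Sum>\<mu>\<in>F. y \<mu>)"
    by blast
  let ?y = "\<lambda>\<mu>. (if \<mu> = \<nu> then scale c v else 0) + (if \<mu> \<in> F then y \<mu> else 0)"
  have "(\<Sum>\<mu>\<in>insert \<nu> F. ?y \<mu>) = scale c v + w"
  proof -
    have "(\<Sum>\<mu>\<in>insert \<nu> F. if \<mu> \<in> F then y \<mu> else 0) = w"
      unfolding *(6) using *(3) by (intro sum.mono_neutral_cong_right) auto
    moreover have "(\<Sum>\<mu>\<in>insert \<nu> F. if \<mu> = \<nu> then scale c v else 0) = scale c v"
      using *(3) by simp
    ultimately show ?thesis
      by (simp only: sum.distrib)
  qed
  moreover have "?y \<mu> \<in> V \<mu>" if "\<mu> \<in> insert \<nu> F" for \<mu>
  proof -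
    have s: "subspace (V \<mu>)"
      using that * assms(2) by blast
    show ?thesis
      using that * subspace_0[OF s] subspace_scale[OF s]
      by (intro subspace_add[OF s]) auto
  qed
  ultimately show ?case
    using * by (intro exI[of _ "insert \<nu> F"] exI[of _ ?y]) auto
qed

text \<open>
  By independence of weight vectors only the summand of weight \<open>\<sigma>\<close> contributes to \<open>x\<close>. With \<open>V\<close>
  the full root spaces this bounds the weights of the core; with \<open>V\<close> the eigenspaces of an automorphism
  it computes the automorphism on the core.
\<close>

lemma weight_component:
  assumes "L \<subseteq> dual" "\<And>\<mu>. \<mu> \<in> L \<Longrightarrow> subspace (V \<mu>)" "\<And>\<mu>. \<mu> \<in> L \<Longrightarrow> V \<mu> \<subseteq> root_space \<mu>"
    and "x \<in> span (\<Union>\<mu>\<in>L. V \<mu>)" "\<sigma> \<in> dual" "x \<in> root_space \<sigma>"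
  shows "x = 0 \<or> (\<sigma> \<in> L \<and> x \<in> V \<sigma>)"
proof -
  obtain F y where F: "finite F" "F \<subseteq> L" "\<And>\<mu>. \<mu> \<in> F \<Longrightarrow> y \<mu> \<in> V \<mu>" "x = (\<Sum>\<mu>\<in>F. y \<mu>)"
    using span_of_weight_subspaces[OF assms(4,2)] by blast
  let ?z = "\<lambda>\<mu>. (if \<mu> \<in> F then y \<mu> else 0) - (if \<mu> = \<sigma> then x else 0)"
  have "(\<Sum>\<mu>\<in>insert \<sigma> F. if \<mu> \<in> F then y \<mu> else 0) = x"
    unfolding F(4) using F(1) by (intro sum.mono_neutral_cong_right) auto
  moreover have "(\<Sum>\<mu>\<in>insert \<sigma> F. if \<mu> = \<sigma> then x else 0) = x"
    using F(1) by simp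
  ultimately have sum: "(\<Sum>\<mu>\<in>insert \<sigma> F. ?z \<mu>) = 0"
    by (simp only: sum_subtractf diff_self)
  have mem: "?z \<mu> \<in> root_space \<mu>" if "\<mu> \<in> insert \<sigma> F" for \<mu>
  proof (rule subspace_diff[OF subspace_root_space])
    show "(if \<mu> \<in> F then y \<mu> else 0) \<in> root_space \<mu>"
      using F(2,3) assms(3) subspace_0[OF subspace_root_space] by auto
    show "(if \<mu> = \<sigma> then x else 0) \<in> root_space \<mu>"
      using assms(6) subspace_0[OF subspace_root_space] by auto
  qed
  have "?z \<sigma> = 0"
    using F(1,2) assms(1,5) by (intro weight_vectors_independent[OF _ _ mem sum]) auto
  then show ?thesis
    using F(2,3) by (auto split: if_splits)
qed

lemma int_span_in_dual:
  assumes "P \<subseteq> dual"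
  shows "int_fun.span P \<subseteq> dual"
proof -
  have "int_fun.subspace dual"
    by (auto simp: int_fun.subspace_def dual_zero dual_add zscale_def dual_scale)
  then show ?thesis
    using assms by (rule int_fun.span_minimal[rotated])
qed

text \<open>
  Let \<open>x\<close> be a nonzero vector of weight \<open>\<sigma>\<close>. If \<open>x\<close> does not commute with some root space of a
  non-isotropic \<open>\<alpha>\<close>, then \<open>\<sigma>\<close> is the difference of the non-isotropic roots \<open>\<alpha> + \<sigma>\<close> and \<open>\<alpha>\<close>.
  Otherwise \<open>x\<close> is in the core by tameness, and all weights of the core are integral combinations of
  non-isotropic roots.
\<close>

lemma isotropic_in_int_span_nonisotropic:
  assumes "\<sigma> \<in> isotropic_roots"
  shows "\<sigma> \<in> int_fun.span nonisotropic_roots"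
proof -
  let ?L = "int_fun.span nonisotropic_roots"
  have \<sigma>: "\<sigma> \<in> roots" "\<sigma> \<in> dual"
    using assms roots_in_dual by (auto simp: isotropic_roots_def)
  have L: "?L \<subseteq> dual"
    using nonisotropic_in_dual by (intro int_span_in_dual) auto
  obtain x where x: "x \<in> root_space \<sigma>" "x \<noteq> 0"
    using \<sigma>(1) by (rule root_vectorE)
  show ?thesis
  proof (cases "\<exists>\<alpha>\<in>nonisotropic_roots. \<exists>z\<in>root_space \<alpha>. bracket x z \<noteq> 0")
    case True
    then obtain \<alpha> z where \<alpha>: "\<alpha> \<in> nonisotropic_roots" "z \<in> root_space \<alpha>" "bracket x z \<noteq> 0"
      by blast
    have "\<alpha> + \<sigma> \<in> roots"
      using bracket_root_space[OF x(1) \<alpha>(2)] \<alpha>(3) dual_add[OF nonisotropic_in_dual[OF \<alpha>(1)] \<sigma>(2)]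
      by (intro rootI[of _ "bracket x z"]) (simp_all add: add.commute)
    then have "\<alpha> + \<sigma> \<in> nonisotropic_roots"
      by (rule isotropic_shift_nonisotropic[OF assms \<alpha>(1)])
    then have "(\<alpha> + \<sigma>) - \<alpha> \<in> ?L"
      using \<alpha>(1) by (intro int_fun.span_diff int_fun.span_base)
    then show ?thesis
      by simp
  next
    case False
    then have "x \<in> core"
      by (intro centralizer_in_core) auto
    moreover have "core \<subseteq> span (\<Union>\<mu>\<in>?L. root_space \<mu>)"
    proof (rule core_subset[OF span_subalgebra])
      fix v w assume "v \<in> (\<Union>\<mu>\<in>?L. root_space \<mu>)" "w \<in> (\<Union>\<mu>\<in>?L. root_space \<mu>)"
      then obtain \<mu> \<nu> where *: "\<mu> \<in> ?L" "\<nu> \<in> ?L" "v \<in> root_space \<mu>" "w \<in> root_space \<nu>"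
        by blast
      then have "\<mu> + \<nu> \<in> ?L" "bracket v w \<in> root_space (\<mu> + \<nu>)"
        using int_fun.span_add bracket_root_space by blast+
      then show "bracket v w \<in> span (\<Union>\<mu>\<in>?L. root_space \<mu>)"
        by (intro span_base) blast
    next
      show "root_space \<alpha> \<subseteq> span (\<Union>\<mu>\<in>?L. root_space \<mu>)" if "\<alpha> \<in> nonisotropic_roots" for \<alpha>
        using that by (auto intro!: span_base intro: int_fun.span_base)
    qed
    ultimately have "x \<in> span (\<Union>\<mu>\<in>?L. root_space \<mu>)"
      by blast
    then have "x = 0 \<or> (\<sigma> \<in> ?L \<and> x \<in> root_space \<sigma>)"
      using L \<sigma>(2) x(1) by (intro weight_component) (auto simp: subspace_root_space)
    then show ?thesis
      using x(2) by blast
  qed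
qed

lemma roots_in_int_span:
  assumes "P \<subseteq> nonisotropic_roots" "generates_roots P"
  shows "roots \<subseteq> int_fun.span P"
proof -
  have "int_fun.span nonisotropic_roots \<subseteq> int_fun.span P"
    using nonisotropic_in_int_span[OF assms] by (intro int_fun.span_minimal) auto
  then show ?thesis
    using nonisotropic_in_int_span[OF assms] isotropic_in_int_span_nonisotropic
    by (auto simp: nonisotropic_roots_def)
qed

text \<open>
  A reflectable base always generates the root lattice, and index zero says that it has as few elements
  as a basis, so it is one.
\<close>

lemma index_zero_int_basis:
  assumes "ind = 0"
  obtains P where "finite P" "P \<subseteq> nonisotropic_roots" "generates_roots P"
    "\<not> int_fun.dependent P" "roots \<subseteq> int_fun.span P"
proof -
  obtain P where P: "reflectable_base P" "finite P" "card P = refl_number"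
    by (rule refl_number_attained)
  then have gen: "P \<subseteq> nonisotropic_roots" "generates_roots P"
    by (auto simp: reflectable_base_def)
  obtain B where "finite_int_basis B roots"
    using root_lattice_free by blast
  moreover have "card P = int_rank roots"
    using assms P(3) by (simp add: ind_def)
  ultimately have "\<not> int_fun.dependent P"
    using generating_set_of_rank_card_independent[OF _ P(2) roots_in_int_span[OF gen]] by blast
  then show ?thesis
    using that[OF P(2) gen _ roots_in_int_span[OF gen]] by blast
qed

end

section \<open>Cartan automorphisms of finite order\<close>

context eala_with_finite_quotient
begin

definition eigen_root_space ::
  "('e \<Rightarrow> 'e) \<Rightarrow> (('e \<Rightarrow> complex) \<Rightarrow> complex) \<Rightarrow> ('e \<Rightarrow> complex) \<Rightarrow> 'e set" where
  "eigen_root_space \<Psi> \<chi> \<alpha> = {x \<in> root_space \<alpha>. \<Psi> x = scale (\<chi> \<alpha>) x}"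

lemma cartan_automorphism_simps:
  assumes "cartan_automorphism \<Psi>"
  shows "\<Psi> (x + y) = \<Psi> x + \<Psi> y" "\<Psi> (scale c x) = scale c (\<Psi> x)"
    "\<Psi> (bracket x y) = bracket (\<Psi> x) (\<Psi> y)" "\<Psi> 0 = 0" "x \<in> H \<Longrightarrow> \<Psi> x = x" "inj \<Psi>"
proof -
  show add: "\<Psi> (x + y) = \<Psi> x + \<Psi> y" for x y
    using assms by (auto simp: cartan_automorphism_def automorphism_def Vector_Spaces.linear_iff)
  show "\<Psi> (scale c x) = scale c (\<Psi> x)" "\<Psi> (bracket x y) = bracket (\<Psi> x) (\<Psi> y)"
    "x \<in> H \<Longrightarrow> \<Psi> x = x"
    using assms by (auto simp: cartan_automorphism_def automorphism_def Vector_Spaces.linear_iff)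
  show "\<Psi> 0 = 0"
    using add[of 0 0] by simp
  show "inj \<Psi>"
    using assms by (auto simp: cartan_automorphism_def automorphism_def bij_def)
qed

lemma cartan_automorphism_root_space:
  assumes "cartan_automorphism \<Psi>" "x \<in> root_space \<alpha>"
  shows "\<Psi> x \<in> root_space \<alpha>"
  unfolding root_space_def
proof (intro CollectI ballI)
  fix h assume h: "h \<in> H"
  have "bracket h (\<Psi> x) = \<Psi> (bracket h x)"
    using cartan_automorphism_simps(3,5)[OF assms(1)] h by simp
  also have "\<dots> = scale (\<alpha> h) (\<Psi> x)"
    using assms h cartan_automorphism_simps(2) by (simp add: root_space_def)
  finally show "bracket h (\<Psi> x) = scale (\<alpha> h) (\<Psi> x)" .
qed

lemma cartan_automorphism_scalar_on_nonisotropic: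
  assumes \<Psi>: "cartan_automorphism \<Psi>" and \<alpha>: "\<alpha> \<in> nonisotropic_roots"
  obtains c where "c \<noteq> 0" "\<And>x. x \<in> root_space \<alpha> \<Longrightarrow> \<Psi> x = scale c x"
proof -
  obtain e where e: "e \<in> root_space \<alpha>" "e \<noteq> 0"
    using nonisotropic_in_roots[OF \<alpha>] by (rule root_vectorE)
  note one_dim = nonisotropic_root_space_one_dimensional[OF \<alpha> e]
  obtain c where c: "\<Psi> e = scale c e"
    using one_dim[OF cartan_automorphism_root_space[OF \<Psi> e(1)]] by blast
  have "\<Psi> e \<noteq> \<Psi> 0"
    using e(2) cartan_automorphism_simps(6)[OF \<Psi>] by (metis injD)
  then have "c \<noteq> 0"
    using c cartan_automorphism_simps(4)[OF \<Psi>] by auto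
  moreover have "\<Psi> x = scale c x" if x: "x \<in> root_space \<alpha>" for x
  proof -
    obtain d where "x = scale d e"
      using one_dim[OF x] by blast
    then show ?thesis
      using c cartan_automorphism_simps(2)[OF \<Psi>] by (simp add: mult.commute)
  qed
  ultimately show ?thesis
    using that by blast
qed

lemma eigen_root_space_eqI:
  assumes \<Psi>: "cartan_automorphism \<Psi>" and \<alpha>: "\<alpha> \<in> nonisotropic_roots"
    and e: "e \<in> eigen_root_space \<Psi> \<chi> \<alpha>" "e \<noteq> 0"
  shows "eigen_root_space \<Psi> \<chi> \<alpha> = root_space \<alpha>"
proof -
  obtain c where c: "\<And>x. x \<in> root_space \<alpha> \<Longrightarrow> \<Psi> x = scale c x"
    using cartan_automorphism_scalar_on_nonisotropic[OF \<Psi> \<alpha>] by metis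
  have "scale c e = scale (\<chi> \<alpha>) e"
    using e(1) c[of e] by (auto simp: eigen_root_space_def)
  then have "c = \<chi> \<alpha>"
    using e(2) by simp
  then show ?thesis
    using c by (auto simp: eigen_root_space_def)
qed

lemma subspace_eigen_root_space:
  assumes "cartan_automorphism \<Psi>"
  shows "subspace (eigen_root_space \<Psi> \<chi> \<alpha>)"
  using subspace_root_space[of \<alpha>] cartan_automorphism_simps[OF assms]
  by (auto simp: subspace_def eigen_root_space_def scale_right_distrib mult.commute)

end

text \<open>
  A character \<open>\<chi>\<close> of the root lattice that gives the action of \<open>\<Psi>\<close> on the root spaces of a generating
  set \<open>P\<close>. The question is on which other root spaces \<open>\<Psi>\<close> acts by \<open>\<chi>\<close>.
\<close>

locale character_of_automorphism = eala_with_finite_quotient scale bracket form H cls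
  for scale :: "complex \<Rightarrow> 'e::ab_group_add \<Rightarrow> 'e" and bracket form H
    and cls :: "('e \<Rightarrow> complex) \<Rightarrow> 'b::ab_group_add" +
  fixes \<Psi> :: "'e \<Rightarrow> 'e" and P :: "('e \<Rightarrow> complex) set" and \<chi> :: "('e \<Rightarrow> complex) \<Rightarrow> complex"
  assumes \<Psi>: "cartan_automorphism \<Psi>"
    and P_nonisotropic: "P \<subseteq> nonisotropic_roots"
    and P_generates: "generates_roots P"
    and roots_spanned: "roots \<subseteq> int_fun.span P"
    and \<chi>_nonzero: "\<chi> \<alpha> \<noteq> 0"
    and \<chi>_add: "\<alpha> \<in> int_fun.span P \<Longrightarrow> \<beta> \<in> int_fun.span P \<Longrightarrow> \<chi> (\<alpha> + \<beta>) = \<chi> \<alpha> * \<chi> \<beta>"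
    and \<chi>_on_P: "\<alpha> \<in> P \<Longrightarrow> x \<in> root_space \<alpha> \<Longrightarrow> \<Psi> x = scale (\<chi> \<alpha>) x"
begin

abbreviation V :: "('e \<Rightarrow> complex) \<Rightarrow> 'e set" where
  "V \<equiv> eigen_root_space \<Psi> \<chi>"

lemma \<chi>_zero: "\<chi> 0 = 1"
  using \<chi>_add[OF int_fun.span_zero int_fun.span_zero] \<chi>_nonzero[of 0] by simp

lemma bracket_V:
  assumes "\<alpha> \<in> int_fun.span P" "\<beta> \<in> int_fun.span P" "x \<in> V \<alpha>" "y \<in> V \<beta>"
  shows "bracket x y \<in> V (\<alpha> + \<beta>)"
  using assms bracket_root_space[of x \<alpha> y \<beta>] cartan_automorphism_simps(3)[OF \<Psi>, of x y]
  by (simp add: eigen_root_space_def \<chi>_add bracket_scale_left bracket_scale_right)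

lemma ad_power_V:
  assumes "\<alpha> \<in> int_fun.span P" "\<beta> \<in> int_fun.span P" "x \<in> V \<alpha>" "y \<in> V \<beta>"
  shows "(bracket x ^^ n) y \<in> V (\<beta> + zscale (int n) \<alpha>)"
proof (induction n)
  case 0
  have "\<beta> + zscale (int 0) \<alpha> = \<beta>"
    by (simp add: zscale_def fun_eq_iff)
  then show ?case
    using assms(4) by (simp only: funpow.simps id_apply)
next
  case (Suc n)
  have "\<alpha> + (\<beta> + zscale (int n) \<alpha>) = \<beta> + zscale (int (Suc n)) \<alpha>"
    by (auto simp: zscale_def fun_eq_iff algebra_simps)
  moreover have "\<beta> + zscale (int n) \<alpha> \<in> int_fun.span P"
    using assms(1,2) by (rule int_fun.span_add[OF _ int_fun.span_scale, rotated])
  ultimately show ?case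
    using bracket_V[OF assms(1) _ assms(3) Suc] by (simp only: funpow.simps o_apply)
qed

text \<open>
  The automorphism fixes \<open>[e, f] \<in> H\<close>, so its scalars on opposite root spaces are inverse to each other.
\<close>

lemma V_minus:
  assumes \<alpha>: "\<alpha> \<in> nonisotropic_roots" and V: "V \<alpha> = root_space \<alpha>"
  shows "V (- \<alpha>) = root_space (- \<alpha>)"
proof -
  have span: "\<alpha> \<in> int_fun.span P" "- \<alpha> \<in> int_fun.span P"
    using roots_spanned nonisotropic_in_roots[OF \<alpha>] by (auto intro: int_fun.span_neg)
  obtain e where e: "e \<in> root_space \<alpha>" "e \<noteq> 0"
    using nonisotropic_in_roots[OF \<alpha>] by (rule root_vectorE)
  obtain f h where f: "f \<in> root_space (- \<alpha>)" "h \<in> H" "bracket e f = h" "form e f \<noteq> 0"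
    "bracket h e = scale 2 e"
    using sl2_triple[OF \<alpha> e] by metis
  have "f \<noteq> 0"
    using f(4) form_zero_right by auto
  have "h \<noteq> 0"
    using f(5) e(2) bracket_zero_left by auto
  obtain c where c: "\<And>x. x \<in> root_space (- \<alpha>) \<Longrightarrow> \<Psi> x = scale c x"
    using cartan_automorphism_scalar_on_nonisotropic[OF \<Psi> minus_nonisotropic[OF \<alpha>]] by metis
  have "\<Psi> e = scale (\<chi> \<alpha>) e"
    using e(1) V by (auto simp: eigen_root_space_def)
  then have "\<Psi> h = scale (\<chi> \<alpha> * c) h"
    using c[OF f(1)] cartan_automorphism_simps(3)[OF \<Psi>, of e f] f(3)
    by (simp add: bracket_scale_left bracket_scale_right mult.commute)
  then have "scale (\<chi> \<alpha> * c) h = scale 1 h"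
    using cartan_automorphism_simps(5)[OF \<Psi> f(2)] by simp
  then have "\<chi> \<alpha> * c = 1"
    by (rule scale_right_imp_eq[OF \<open>h \<noteq> 0\<close>])
  moreover have "\<chi> \<alpha> * \<chi> (- \<alpha>) = 1"
    using \<chi>_add[OF span] \<chi>_zero by simp
  ultimately have "c = \<chi> (- \<alpha>)"
    using \<chi>_nonzero[of \<alpha>] by (metis mult_cancel_left)
  then show ?thesis
    using c by (auto simp: eigen_root_space_def)
qed

text \<open>
  The property holds on \<open>P\<close>, passes to \<open>- \<alpha>\<close>, and passes from \<open>\<beta>\<close> to its reflection in \<open>\<gamma> \<in> P\<close>:
  the vector \<open>e\<^sup>n x\<close> in the reflected root space is an eigenvector for the right scalar, and that space is
  one-dimensional. Since \<open>P\<close> generates the non-isotropic roots, all of them are reached.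
\<close>

lemma V_eq_root_space:
  assumes "\<alpha> \<in> nonisotropic_roots"
  shows "V \<alpha> = root_space \<alpha>"
proof -
  let ?N = "{\<alpha> \<in> nonisotropic_roots. V \<alpha> = root_space \<alpha>}"
  have "orbit P \<subseteq> ?N"
  proof (rule orbit_subset[OF P_nonisotropic])
    show "?N \<subseteq> dual"
      using nonisotropic_in_dual by blast
    show P: "P \<subseteq> ?N"
      using P_nonisotropic \<chi>_on_P by (auto simp: eigen_root_space_def)
    fix \<gamma> \<beta> assume *: "\<gamma> \<in> P" "\<beta> \<in> ?N"
    then have ni: "\<gamma> \<in> nonisotropic_roots" "\<beta> \<in> nonisotropic_roots" and V: "V \<gamma> = root_space \<gamma>" "V \<beta> = root_space \<beta>"
      using P by auto
    obtain k where k: "cartan_number \<gamma> \<beta> = of_int k"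
      using cartan_integer[OF ni] by blast
    obtain \<epsilon> n where \<epsilon>: "\<epsilon> \<in> {\<gamma>, - \<gamma>}" "cartan_number \<epsilon> \<beta> = - of_nat n"
      "reflection \<epsilon> \<beta> = reflection \<gamma> \<beta>" "reflection \<gamma> \<beta> \<in> nonisotropic_roots"
      using reflection_nonisotropic[OF ni k] by metis
    have ni_\<epsilon>: "\<epsilon> \<in> nonisotropic_roots" and V_\<epsilon>: "V \<epsilon> = root_space \<epsilon>"
      using \<epsilon>(1) ni(1) V(1) minus_nonisotropic V_minus by auto
    obtain e where e: "e \<in> root_space \<epsilon>" "e \<noteq> 0"
      using nonisotropic_in_roots[OF ni_\<epsilon>] by (rule root_vectorE)
    obtain x where x: "x \<in> root_space \<beta>" "x \<noteq> 0"
      using nonisotropic_in_roots[OF ni(2)] by (rule root_vectorE)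
    have span: "\<epsilon> \<in> int_fun.span P" "\<beta> \<in> int_fun.span P"
      using ni_\<epsilon> ni(2) roots_spanned nonisotropic_in_roots by auto
    have "(bracket e ^^ n) x \<in> V (\<beta> + zscale (int n) \<epsilon>)"
      using ad_power_V[OF span] e(1) x(1) V(2) V_\<epsilon> by simp
    moreover have "reflection \<epsilon> \<beta> = \<beta> + zscale (int n) \<epsilon>"
      unfolding reflection_def \<epsilon>(2) by (simp add: zscale_def fun_eq_iff)
    moreover have "(bracket e ^^ n) x \<noteq> 0"
      by (rule raising_to_reflected_root_space(2)[OF ni_\<epsilon> nonisotropic_in_dual[OF ni(2)] \<epsilon>(2) e x])
    ultimately have "V (reflection \<gamma> \<beta>) = root_space (reflection \<gamma> \<beta>)"
      using eigen_root_space_eqI[OF \<Psi> \<epsilon>(4)] \<epsilon>(3) by metis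
    then show "reflection \<gamma> \<beta> \<in> ?N"
      using \<epsilon>(4) by blast
  qed
  then show ?thesis
    using assms P_generates by (auto simp: generates_roots_iff)
qed

lemma core_eigenvector:
  assumes "\<sigma> \<in> roots" "y \<in> root_space \<sigma>" "y \<in> core"
  shows "\<Psi> y = scale (\<chi> \<sigma>) y"
proof -
  let ?L = "int_fun.span P"
  have L: "?L \<subseteq> dual"
    using P_nonisotropic nonisotropic_in_dual by (intro int_span_in_dual) auto
  have "core \<subseteq> span (\<Union>\<mu>\<in>?L. V \<mu>)"
  proof (rule core_subset[OF span_subalgebra])
    fix v w assume "v \<in> (\<Union>\<mu>\<in>?L. V \<mu>)" "w \<in> (\<Union>\<mu>\<in>?L. V \<mu>)"
    then obtain \<mu> \<nu> where *: "\<mu> \<in> ?L" "\<nu> \<in> ?L" "v \<in> V \<mu>" "w \<in> V \<nu>"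
      by blast
    then have "\<mu> + \<nu> \<in> ?L" "bracket v w \<in> V (\<mu> + \<nu>)"
      using int_fun.span_add bracket_V by blast+
    then show "bracket v w \<in> span (\<Union>\<mu>\<in>?L. V \<mu>)"
      by (intro span_base) blast
  next
    fix \<alpha> assume \<alpha>: "\<alpha> \<in> nonisotropic_roots"
    then have "\<alpha> \<in> ?L"
      using roots_spanned nonisotropic_in_roots by blast
    then show "root_space \<alpha> \<subseteq> span (\<Union>\<mu>\<in>?L. V \<mu>)"
      unfolding V_eq_root_space[OF \<alpha>, symmetric] by (auto intro: span_base)
  qed
  then have "y \<in> span (\<Union>\<mu>\<in>?L. V \<mu>)"
    using assms(3) by blast
  then have "y = 0 \<or> (\<sigma> \<in> ?L \<and> y \<in> V \<sigma>)"
    using L roots_in_dual[OF assms(1)] assms(2)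
    by (intro weight_component) (auto simp: subspace_eigen_root_space[OF \<Psi>], auto simp: eigen_root_space_def)
  then show ?thesis
    using cartan_automorphism_simps(4)[OF \<Psi>] by (auto simp: eigen_root_space_def)
qed

text \<open>
  For \<open>z\<close> in a non-isotropic root space of \<open>\<alpha>\<close>, the bracket \<open>[x, z]\<close> lies in the root space of the
  non-isotropic \<open>\<alpha> + \<sigma>\<close> or is zero. The automorphism therefore acts by \<open>\<chi>\<close> on both \<open>z\<close> and \<open>[x, z]\<close>, which
  forces the deviation of \<open>x\<close> from being an eigenvector to commute with \<open>z\<close>.
\<close>

lemma isotropic_deviation_in_core:
  assumes \<sigma>: "\<sigma> \<in> isotropic_roots" and x: "x \<in> root_space \<sigma>"
  shows "scale (inverse (\<chi> \<sigma>)) (\<Psi> x) - x \<in> core"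
proof (rule centralizer_in_core)
  fix \<alpha> z assume \<alpha>: "\<alpha> \<in> nonisotropic_roots" and z: "z \<in> root_space \<alpha>"
  have \<sigma>': "\<sigma> \<in> roots"
    using \<sigma> by (simp add: isotropic_roots_def)
  have span: "\<alpha> \<in> int_fun.span P" "\<sigma> \<in> int_fun.span P"
    using roots_spanned nonisotropic_in_roots[OF \<alpha>] \<sigma>' by auto
  have xz: "bracket x z \<in> root_space (\<alpha> + \<sigma>)"
    using bracket_root_space[OF x z] by (simp add: add.commute)
  have "\<Psi> (bracket x z) = scale (\<chi> \<alpha> * \<chi> \<sigma>) (bracket x z)"
  proof (cases "bracket x z = 0")
    case True
    then show ?thesis
      using cartan_automorphism_simps(4)[OF \<Psi>] by simp
  next
    case False
    have "\<alpha> + \<sigma> \<in> nonisotropic_roots"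
      using rootI[OF _ xz False] dual_add nonisotropic_in_dual[OF \<alpha>] roots_in_dual[OF \<sigma>']
      by (intro isotropic_shift_nonisotropic[OF \<sigma> \<alpha>]) auto
    then have "bracket x z \<in> V (\<alpha> + \<sigma>)"
      using xz V_eq_root_space by simp
    then show ?thesis
      using \<chi>_add[OF span] by (simp add: eigen_root_space_def)
  qed
  moreover have "\<Psi> (bracket x z) = scale (\<chi> \<alpha>) (bracket (\<Psi> x) z)"
  proof -
    have "\<Psi> z = scale (\<chi> \<alpha>) z"
      using z V_eq_root_space[OF \<alpha>] by (auto simp: eigen_root_space_def)
    then show ?thesis
      using cartan_automorphism_simps(3)[OF \<Psi>] by (simp add: bracket_scale_right)
  qed
  ultimately have "scale (\<chi> \<alpha>) (bracket (\<Psi> x) z) = scale (\<chi> \<alpha>) (scale (\<chi> \<sigma>) (bracket x z))"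
    by simp
  then have "bracket (\<Psi> x) z = scale (\<chi> \<sigma>) (bracket x z)"
    using \<chi>_nonzero[of \<alpha>] scale_left_imp_eq by blast
  then show "bracket (scale (inverse (\<chi> \<sigma>)) (\<Psi> x) - x) z = 0"
    using \<chi>_nonzero[of \<sigma>] by (simp add: bracket_diff_left bracket_scale_left)
qed

text \<open>
  On the root space of an isotropic \<open>\<sigma>\<close> the automorphism is \<open>\<chi> \<sigma> (1 + D)\<close>, where \<open>D x = y\<close> lies in the
  core and hence \<open>D y = 0\<close>. So the automorphism is a scalar times a unipotent operator, and such an
  operator has finite order only if \<open>D = 0\<close>.
\<close>

lemma finite_order_diagonal:
  assumes "n > 0" "\<Psi> ^^ n = id"
  shows "diagonal \<Psi>"
proof -
  have "\<Psi> x = scale (\<chi> \<sigma>) x" if \<sigma>: "\<sigma> \<in> roots" and x: "x \<in> root_space \<sigma>" for \<sigma> x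
  proof (cases "\<sigma> \<in> isotropic_roots")
    case False
    then have "V \<sigma> = root_space \<sigma>"
      using \<sigma> by (intro V_eq_root_space) (simp add: nonisotropic_roots_def)
    then show ?thesis
      using x by (auto simp: eigen_root_space_def)
  next
    case True
    define y where "y = scale (inverse (\<chi> \<sigma>)) (\<Psi> x) - x"
    have "y \<in> root_space \<sigma>"
      unfolding y_def
      by (intro subspace_diff[OF subspace_root_space] subspace_scale[OF subspace_root_space]
          cartan_automorphism_root_space[OF \<Psi>] x)
    then have y: "\<Psi> y = scale (\<chi> \<sigma>) y"
      using core_eigenvector[OF \<sigma>] isotropic_deviation_in_core[OF True x] unfolding y_def by blast
    have \<Psi>x: "\<Psi> x = scale (\<chi> \<sigma>) (x + y)"
      using \<chi>_nonzero[of \<sigma>] by (simp add: y_def)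
    have pow: "(\<Psi> ^^ k) y = scale (\<chi> \<sigma> ^ k) y"
      "(\<Psi> ^^ k) x = scale (\<chi> \<sigma> ^ k) (x + scale (of_nat k) y)" for k
    proof (induction k)
      case 0
      {
        case 1 show ?case by simp
      next
        case 2 show ?case by simp
      }
    next
      case (Suc k)
      {
        case 1 show ?case
          using Suc(1) y cartan_automorphism_simps(2)[OF \<Psi>] by (simp add: mult.commute)
      next
        case 2
        have "(\<Psi> ^^ Suc k) x = scale (\<chi> \<sigma> ^ k) (\<Psi> x + scale (of_nat k) (\<Psi> y))"
          using Suc(2) cartan_automorphism_simps(1,2)[OF \<Psi>] by simp
        also have "\<dots> = scale (\<chi> \<sigma> ^ k * \<chi> \<sigma>) (x + y + scale (of_nat k) y)"
          unfolding \<Psi>x y by (simp add: scale_right_distrib mult_ac)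
        also have "x + y + scale (of_nat k) y = x + scale (of_nat (Suc k)) y"
          by (simp add: scale_left_distrib add.assoc)
        finally show ?case
          by (simp only: power_Suc mult.commute)
      }
    qed
    have "y = 0"
    proof (rule ccontr)
      assume "y \<noteq> 0"
      have "scale (\<chi> \<sigma> ^ n) y = scale 1 y"
        using pow(1)[of n] assms(2) by simp
      then have "\<chi> \<sigma> ^ n = 1"
        by (rule scale_right_imp_eq[OF \<open>y \<noteq> 0\<close>])
      then have "x = x + scale (of_nat n) y"
        using pow(2)[of n] assms(2) by simp
      then have "scale (of_nat n) y = 0"
        by simp
      then show False
        using \<open>y \<noteq> 0\<close> assms(1) by simp
    qed
    then show ?thesis
      using \<Psi>x by simp
  qed
  then show ?thesis
    unfolding diagonal_def by blast
qed

end

context eala_with_finite_quotient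
begin

lemma finite_order_cartan_automorphism_diagonal:
  assumes "ind = 0" and \<Psi>: "cartan_automorphism \<Psi>" and n: "n > 0" "\<Psi> ^^ n = id"
  shows "diagonal \<Psi>"
proof -
  obtain P where P: "finite P" "P \<subseteq> nonisotropic_roots" "generates_roots P"
    "\<not> int_fun.dependent P" "roots \<subseteq> int_fun.span P"
    using index_zero_int_basis[OF assms(1)] by blast
  have "\<exists>c. c \<noteq> 0 \<and> (\<forall>x\<in>root_space \<alpha>. \<Psi> x = scale c x)" if "\<alpha> \<in> P" for \<alpha>
    using cartan_automorphism_scalar_on_nonisotropic[OF \<Psi>, of \<alpha>] that P(2) by (metis subsetD)
  then obtain c where c: "\<And>\<alpha>. \<alpha> \<in> P \<Longrightarrow> c \<alpha> \<noteq> 0 \<and> (\<forall>x\<in>root_space \<alpha>. \<Psi> x = scale (c \<alpha>) x)"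
    by metis
  obtain \<chi> where \<chi>: "\<And>p. p \<in> P \<Longrightarrow> \<chi> p = c p" "\<And>x. \<chi> x \<noteq> 0"
    "\<And>x y. x \<in> int_fun.span P \<Longrightarrow> y \<in> int_fun.span P \<Longrightarrow> \<chi> (x + y) = \<chi> x * \<chi> y"
    using character_with_values_on_basis[OF P(4,1), of c] c by metis
  interpret character_of_automorphism scale bracket form H cls \<Psi> P \<chi>
  proof unfold_locales
    show "\<Psi> x = scale (\<chi> \<alpha>) x" if "\<alpha> \<in> P" "x \<in> root_space \<alpha>" for \<alpha> x
      using c \<chi>(1) that by simp
  qed (fact \<Psi> P(2,3,5) \<chi>(2,3))+
  show ?thesis
    by (rule finite_order_diagonal[OF n])
qed

end

section \<open>Type B\<close>

lemma coord_inner_units: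
  assumes "i < l" "j < l"
  shows "coord_inner l (coord_unit i) (coord_unit j) = (if i = j then 1 else 0)"
proof -
  have "coord_inner l (coord_unit i) (coord_unit j) = (\<Sum>k<l. if k = i then (if i = j then 1 else 0) else 0)"
    unfolding coord_inner_def coord_unit_def by (intro sum.cong) auto
  then show ?thesis
    using assms(1) by simp
qed

lemma coord_inner_bilinear:
  "coord_inner l (u + v) w = coord_inner l u w + coord_inner l v w"
  "coord_inner l (u - v) w = coord_inner l u w - coord_inner l v w"
  "coord_inner l (- u) w = - coord_inner l u w"
  "coord_inner l w (u + v) = coord_inner l w u + coord_inner l w v"
  "coord_inner l w (u - v) = coord_inner l w u - coord_inner l w v"
  "coord_inner l w (- u) = - coord_inner l w u"
  by (simp_all add: coord_inner_def algebra_simps sum.distrib sum_subtractf sum_negf)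

lemma B_roots_cases:
  assumes "v \<in> B_roots l"
  obtains i where "i < l" "v = coord_unit i \<or> v = - coord_unit i"
  | i j where "i < l" "j < l" "i \<noteq> j"
    "v = coord_unit i + coord_unit j \<or> v = coord_unit i - coord_unit j \<or> v = - coord_unit i - coord_unit j"
  using assms unfolding B_roots_def by blast

lemma B_roots_length:
  assumes "v \<in> B_roots l"
  shows "coord_inner l v v \<in> {1, 2}"
  using assms by (cases rule: B_roots_cases) (auto simp: coord_inner_bilinear coord_inner_units)

lemma B_roots_inner_integer:
  assumes "v \<in> B_roots l" "w \<in> B_roots l"
  shows "coord_inner l v w \<in> \<int>"
proof -
  have unit: "coord_inner l (coord_unit i) (coord_unit j) \<in> \<int>" if "i < l" "j < l" for i j
    using that by (simp add: coord_inner_units)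
  have v: "coord_inner l v (coord_unit j) \<in> \<int>" if "j < l" for j
    using assms(1) by (cases rule: B_roots_cases)
      (auto simp: coord_inner_bilinear unit that intro!: Ints_add Ints_diff Ints_minus)
  show ?thesis
    using assms(2) by (cases rule: B_roots_cases)
      (auto simp: coord_inner_bilinear v intro!: Ints_add Ints_diff Ints_minus)
qed

lemma B_roots_cartan_integer:
  assumes "v \<in> B_roots l" "w \<in> B_roots l"
  shows "\<exists>k::int. 2 * coord_inner l v w / coord_inner l v v = of_int k"
proof -
  obtain k where "coord_inner l v w = of_int k"
    using B_roots_inner_integer[OF assms] by (auto elim: Ints_cases)
  then show ?thesis
    using B_roots_length[OF assms(1)] by (auto intro: exI[of _ "2 * k"] exI[of _ k])
qed

lemma finite_B_roots: "finite (B_roots l)"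
proof -
  have "B_roots l \<subseteq> (\<Union>i<l. {coord_unit i, - coord_unit i}) \<union>
    (\<Union>i<l. \<Union>j<l. {coord_unit i + coord_unit j, coord_unit i - coord_unit j, - coord_unit i - coord_unit j})"
    unfolding B_roots_def by auto
  then show ?thesis
    by (rule finite_subset) auto
qed

text \<open>
  The coset map composed with the isomorphism onto coordinate space serves as the class map. A
  non-isotropic root has nonzero image because its Cartan number with itself is \<open>2\<close> and the image has
  the same Cartan numbers.
\<close>

lemma (in extended_affine_lie_algebra) type_B_finite_quotient:
  assumes "has_type_B l"
  obtains cls :: "('e \<Rightarrow> complex) \<Rightarrow> nat \<Rightarrow> real"
    where "eala_with_finite_quotient scale bracket form H cls"
proof -
  obtain \<phi> where add': "\<forall>\<alpha>\<in>root_span. \<forall>\<beta>\<in>root_span. \<phi> (bar (\<alpha> + \<beta>)) = \<phi> (bar \<alpha>) + \<phi> (bar \<beta>)"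
    and image: "\<phi> ` (bar ` roots) = insert 0 (B_roots l)"
    and cartan': "\<forall>\<alpha>\<in>nonisotropic_roots. \<forall>\<beta>\<in>nonisotropic_roots.
       cartan_number \<alpha> \<beta> = of_real (2 * coord_inner l (\<phi> (bar \<alpha>)) (\<phi> (bar \<beta>))
                        / coord_inner l (\<phi> (bar \<alpha>)) (\<phi> (bar \<alpha>)))"
    using assms unfolding has_type_B_def by (elim exE conjE)
  have add: "\<phi> (bar (\<alpha> + \<beta>)) = \<phi> (bar \<alpha>) + \<phi> (bar \<beta>)"
    if "\<alpha> \<in> root_span" "\<beta> \<in> root_span" for \<alpha> \<beta>
    using add' that by blast
  have cartan: "cartan_number \<alpha> \<beta> = of_real (2 * coord_inner l (\<phi> (bar \<alpha>)) (\<phi> (bar \<beta>))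
        / coord_inner l (\<phi> (bar \<alpha>)) (\<phi> (bar \<alpha>)))"
    if "\<alpha> \<in> nonisotropic_roots" "\<beta> \<in> nonisotropic_roots" for \<alpha> \<beta>
    using cartan' that by blast
  have zero: "\<phi> (bar 0) = 0"
    using add[of 0 0] by (simp add: root_span_def real_fun.span_zero)
  have inner: "coord_inner l (\<phi> (bar \<alpha>)) (\<phi> (bar \<alpha>)) \<noteq> 0" if "\<alpha> \<in> nonisotropic_roots" for \<alpha>
    using cartan[OF that that] that by (auto simp: nonisotropic_iff)
  have nz: "\<phi> (bar \<alpha>) \<noteq> 0" if "\<alpha> \<in> nonisotropic_roots" for \<alpha>
    using inner[OF that] by (auto simp: coord_inner_def)
  have B: "\<phi> (bar \<alpha>) \<in> B_roots l" if "\<alpha> \<in> nonisotropic_roots" for \<alpha>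
    using image nz[OF that] nonisotropic_in_roots[OF that] by blast
  have "eala_with_finite_quotient scale bracket form H (\<lambda>\<alpha>. \<phi> (bar \<alpha>))"
  proof unfold_locales
    show "\<phi> (bar (\<alpha> + \<beta>)) = \<phi> (bar \<alpha>) + \<phi> (bar \<beta>)" if "\<alpha> \<in> root_span" "\<beta> \<in> root_span" for \<alpha> \<beta>
      using that by (rule add)
    show "\<phi> (bar \<sigma>) = 0" if "\<sigma> \<in> isotropic_roots" for \<sigma>
    proof -
      have \<sigma>: "\<sigma> \<in> isotropic_span"
        unfolding isotropic_span_def using that by (rule real_fun.span_base)
      have "\<beta> - \<sigma> \<in> isotropic_span \<longleftrightarrow> \<beta> \<in> isotropic_span" for \<beta>
        using \<sigma> real_fun.span_add[of "\<beta> - \<sigma>" isotropic_roots \<sigma>] unfolding isotropic_span_def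
        by (auto intro: real_fun.span_diff)
      then have "bar \<sigma> = bar 0"
        by (simp add: bar_def)
      with zero show ?thesis
        by simp
    qed
    show "\<phi> (bar \<alpha>) \<noteq> 0" if "\<alpha> \<in> nonisotropic_roots" for \<alpha>
      using that by (rule nz)
    show "finite ((\<lambda>\<alpha>. \<phi> (bar \<alpha>)) ` nonisotropic_roots)"
      using B by (intro finite_subset[OF _ finite_B_roots[of l]]) auto
    show "\<exists>k. cartan_number \<alpha> \<beta> = of_int k"
      if "\<alpha> \<in> nonisotropic_roots" "\<beta> \<in> nonisotropic_roots" for \<alpha> \<beta>
      using B_roots_cartan_integer[OF B B, OF that] unfolding cartan[OF that] by (metis of_real_of_int_eq)
    show "cartan_number \<alpha> \<beta> = 2"
      if "\<alpha> \<in> nonisotropic_roots" "\<beta> \<in> nonisotropic_roots" "\<phi> (bar \<alpha>) = \<phi> (bar \<beta>)" for \<alpha> \<beta>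
      using cartan[OF that(1,2)] inner[OF that(2)] unfolding that(3) by simp
  qed
  then show ?thesis
    by (rule that)
qed

theorem proposition4p4p7:
  fixes scale :: "complex \<Rightarrow> 'e::ab_group_add \<Rightarrow> 'e"
    and bracket :: "'e \<Rightarrow> 'e \<Rightarrow> 'e"
    and form :: "'e \<Rightarrow> 'e \<Rightarrow> complex"
    and H :: "'e set"
    and l :: nat
    and \<Psi> :: "'e \<Rightarrow> 'e"
  assumes "extended_affine_lie_algebra scale bracket form H"
    and "l \<ge> 2"
    and "lie_algebra_form.has_type_B scale bracket form H l"
    and "lie_algebra_form.ind scale bracket form H = 0"
    and "lie_algebra_form.cartan_automorphism scale bracket H \<Psi>"
    and "\<exists>n>0. \<Psi> ^^ n = id"
  shows "lie_algebra_form.diagonal scale bracket H \<Psi>"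
proof -
  obtain cls :: "('e \<Rightarrow> complex) \<Rightarrow> nat \<Rightarrow> real"
    where "eala_with_finite_quotient scale bracket form H cls"
    using extended_affine_lie_algebra.type_B_finite_quotient[OF assms(1,3)] by blast
  then show ?thesis
    using eala_with_finite_quotient.finite_order_cartan_automorphism_diagonal assms(4-6) by blast
qed

end
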